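(* Let $\omega>0$ be a given constant, let $\pi_0$ be a probability density on $\mathbb{R}$ satisfying conditions [C.2] and [C.3] with polynomial order $\alpha>1$, and let the true parameters $\theta^*\in\mathbb{R}^n$ have exactly $s=s^{(n)}$ nonzero entries with $s=o(n)$ (condition [C.1]). Let the global shrinkage parameter $\tau=\tau_n>0$ be deterministic. If $$\tau^{\alpha-1}\geq (s/n)^c\{\log(n/s)\}^{1/2}\ \text{ for some constant } c\in(0,1+\omega/2),\qquad \tau^{\alpha-1}\prec \{(s/n)\log(n/s)\}^{\alpha},$$ then $$\lim_{n\to\infty} E^*\Big(\pi\big[\|\theta-\theta^*\|\geq C_1(\omega)\{s\log(n/s)\}^{1/2}\,\big|\,D_n\big]\Big)=0,$$ where $C_1(\omega)=\sqrt{2+\omega}+\sqrt{\omega}$, which satisfies $\lim_{\omega\downarrow 0}C_1(\omega)=\sqrt2$. If furthermore $\tau^{\alpha-1}\prec (s/n)^\alpha\{\log(n/s)\}^{(\alpha+1)/2}$, then $$\lim_{n\to\infty} E^*\Big(\pi\big[\|\theta-\theta^*\|_1\geq s\,C_2(\omega)\{\log(n/s)\}^{1/2}\,\big|\,D_n\big]\Big)=0,$$ where $C_2(\omega)=\sqrt{2+\omega}+\sqrt{\omega^2/5}+\sqrt{\omega/5}$, which satisfies $\lim_{\omega\downarrow 0}C_2(\omega)=\sqrt2$.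
   Context: Model: for each $n$ one observes $D_n=\{y_i\}_{i=1}^n$ with $y=\theta+\epsilon$, where $y=(y_1,\dots,y_n)^T\in\mathbb{R}^n$, $\epsilon\sim N(0,I_n)$, and $\theta=(\theta_1,\dots,\theta_n)^T\in\mathbb{R}^n$ is the unknown parameter. The true value $\theta^*=\theta^{*(n)}\in\mathbb{R}^n$ has $s=s^{(n)}\ge 1$ nonzero entries; $s$ may grow with $n$. $E^*$ denotes expectation over the data $D_n$ generated under the true parameter $\theta^*$. The asymptotics are as $n\to\infty$; $\pi_0$, $\alpha$, $\omega$, $c$ do not depend on $n$. Prior: given the global shrinkage parameter $\tau>0$, $\pi(\theta|\tau)=\prod_{i=1}^n (1/\tau)\pi_0(\theta_i/\tau)$. Here $\tau=\tau_n$ is a deterministic sequence. $\pi(\cdot|D_n)$ denotes the posterior distribution of $\theta$ given $D_n$. Conditions: [C.1] $s=o(n)$. [C.2] The density $\pi_0(\cdot)$ is strictly decreasing on $(0,\infty)$ and increasing on $(-\infty,0)$. [C.3] The tail of $\pi_0$ is polynomially decaying with polynomial order $\alpha>1$: there exist positive constants $M$ and $K_2>K_1$ such that $K_1|\theta|^{-\alpha}\le \pi_0(\theta)\le K_2|\theta|^{-\alpha}$ for all $|\theta|>M$. Notation: $\|\cdot\|$ and $\|\cdot\|_1$ are the $L_2$ and $L_1$ norms of a vector. For positive sequences, $a_n\prec b_n$ means $\lim (b_n/a_n)=\infty$. *)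

theory Defs
  imports "HOL-Probability.Probability" "HOL-Library.Landau_Symbols"
begin

text \<open>
  Vectors in $\mathbb{R}^n$, with $n$ varying along the asymptotics, are functions
  \<^typ>\<open>nat \<Rightarrow> real\<close> of which only the values at indices \<open>i < n\<close> matter.
  Measures on $\mathbb{R}^n$ live on the finite product space over \<open>{..<n}\<close>.
\<close>

definition noise_law :: "nat \<Rightarrow> (nat \<Rightarrow> real) measure" where
  "noise_law n = (\<Pi>\<^sub>M i\<in>{..<n}. density lborel (\<lambda>x. ennreal (std_normal_density x)))"

definition data_law :: "nat \<Rightarrow> (nat \<Rightarrow> real) \<Rightarrow> (nat \<Rightarrow> real) measure" where
  "data_law n \<theta> =
     distr (noise_law n) (\<Pi>\<^sub>M i\<in>{..<n}. lborel) (\<lambda>\<epsilon>. \<lambda>i\<in>{..<n}. \<theta> i + \<epsilon> i)"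

definition likelihood :: "nat \<Rightarrow> (nat \<Rightarrow> real) \<Rightarrow> (nat \<Rightarrow> real) \<Rightarrow> real" where
  "likelihood n \<theta> y = (\<Prod>i<n. normal_density (\<theta> i) 1 (y i))"

definition prior :: "nat \<Rightarrow> (real \<Rightarrow> real) \<Rightarrow> real \<Rightarrow> (nat \<Rightarrow> real) measure" where
  "prior n \<pi>0 \<tau> =
     density (\<Pi>\<^sub>M i\<in>{..<n}. lborel) (\<lambda>\<theta>. ennreal (\<Prod>i<n. (1 / \<tau>) * \<pi>0 (\<theta> i / \<tau>)))"

text \<open>Bayes' formula. The normalising constant is the marginal density of \<open>y\<close>.\<close>

definition posterior ::
  "nat \<Rightarrow> (real \<Rightarrow> real) \<Rightarrow> real \<Rightarrow> (nat \<Rightarrow> real) \<Rightarrow> (nat \<Rightarrow> real) measure" where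
  "posterior n \<pi>0 \<tau> y =
     density (prior n \<pi>0 \<tau>)
       (\<lambda>\<theta>. ennreal (likelihood n \<theta> y) /
            (\<integral>\<^sup>+ \<theta>'. ennreal (likelihood n \<theta>' y) \<partial>prior n \<pi>0 \<tau>))"

definition probability_density :: "(real \<Rightarrow> real) \<Rightarrow> bool" where
  "probability_density f \<longleftrightarrow>
     f \<in> borel_measurable borel \<and> (\<forall>x. 0 \<le> f x) \<and> (\<integral>\<^sup>+ x. ennreal (f x) \<partial>lborel) = 1"

text \<open>Strict monotonicity is only imposed on the positive half-line. No condition is put on
  the value at \<open>0\<close>, so a density with a pole there is allowed.\<close>

definition unimodal_at_zero :: "(real \<Rightarrow> real) \<Rightarrow> bool" where
  "unimodal_at_zero f \<longleftrightarrow> strict_antimono_on {0<..} f \<and> mono_on {..<0} f"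

definition polynomial_tail :: "real \<Rightarrow> (real \<Rightarrow> real) \<Rightarrow> bool" where
  "polynomial_tail \<alpha> f \<longleftrightarrow>
     (\<exists>M K1 K2. 0 < M \<and> 0 < K1 \<and> K1 < K2 \<and>
        (\<forall>x. M < \<bar>x\<bar> \<longrightarrow> K1 * \<bar>x\<bar> powr (- \<alpha>) \<le> f x \<and> f x \<le> K2 * \<bar>x\<bar> powr (- \<alpha>)))"

definition precedes :: "(nat \<Rightarrow> real) \<Rightarrow> (nat \<Rightarrow> real) \<Rightarrow> bool" (infix "\<prec>\<prec>" 50) where
  "a \<prec>\<prec> b \<longleftrightarrow> filterlim (\<lambda>n. b n / a n) at_top sequentially"

definition nonzero_count :: "nat \<Rightarrow> (nat \<Rightarrow> real) \<Rightarrow> nat" where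
  "nonzero_count n \<theta> = card {i. i < n \<and> \<theta> i \<noteq> 0}"

definition l2_dist :: "nat \<Rightarrow> (nat \<Rightarrow> real) \<Rightarrow> (nat \<Rightarrow> real) \<Rightarrow> real" where
  "l2_dist n \<theta> \<eta> = L2_set (\<lambda>i. \<theta> i - \<eta> i) {..<n}"

definition l1_dist :: "nat \<Rightarrow> (nat \<Rightarrow> real) \<Rightarrow> (nat \<Rightarrow> real) \<Rightarrow> real" where
  "l1_dist n \<theta> \<eta> = (\<Sum>i<n. \<bar>\<theta> i - \<eta> i\<bar>)"

definition expected_posterior ::
  "nat \<Rightarrow> (real \<Rightarrow> real) \<Rightarrow> real \<Rightarrow> (nat \<Rightarrow> real) \<Rightarrow> ((nat \<Rightarrow> real) \<Rightarrow> bool) \<Rightarrow> real" where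
  "expected_posterior n \<pi>0 \<tau> \<theta>\<^sub>0 P =
     (\<integral>y. measure (posterior n \<pi>0 \<tau> y) {\<theta> \<in> space (posterior n \<pi>0 \<tau> y). P \<theta>} \<partial>data_law n \<theta>\<^sub>0)"

definition C1 :: "real \<Rightarrow> real" where
  "C1 \<omega> = sqrt (2 + \<omega>) + sqrt \<omega>"

definition C2 :: "real \<Rightarrow> real" where
  "C2 \<omega> = sqrt (2 + \<omega>) + sqrt (\<omega>\<^sup>2 / 5) + sqrt (\<omega> / 5)"

end

theory Submission
  imports Defs "HOL-Real_Asymp.Real_Asymp"
begin

text \<open>
  Prior and likelihood are products, so the posterior factorises over coordinates, and everything
  reduces to one coordinate with data \<open>y\<close>, prior density \<open>q(\<theta>) = \<pi>0(\<theta>/\<tau>)/\<tau>\<close> and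
  marginal \<open>m(y) = \<integral> \<phi>(y - \<theta>) q(\<theta>) d\<theta>\<close>. Write \<open>b = \<tau> powr (\<alpha> - 1)\<close>, \<open>r = s/n\<close> and \<open>L = ln (1/r)\<close>.
  The prior has a spike of constant mass near \<open>0\<close> and a tail of density about
  \<open>b \<bar>\<theta>\<bar> powr (-\<alpha>)\<close>. This gives two lower bounds for the marginal: \<open>m(y) \<ge> const \<phi>(y)\<close> for every \<open>y\<close>
  (\<open>marginal_ge_at_origin\<close>), and \<open>m(y) \<ge> const b \<bar>y\<bar> powr (-\<alpha>)\<close> for \<open>\<bar>y\<bar> \<ge> 1\<close> (\<open>marginal_ge_tail\<close>).

  At a coordinate with a zero true value, \<open>y\<close> has density \<open>\<phi>\<close>, and by the first bound the
  factor \<open>\<phi>(y)/m(y)\<close> is bounded. Up to a constant, the expected posterior moment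
  is therefore the prior moment of \<open>\<theta>\<close> truncated at a level of order \<open>sqrt L\<close>, plus the
  contribution of \<open>\<bar>y\<bar> > 2 sqrt L\<close>, which is of order \<open>r\<close> (\<open>null_coordinate_risk\<close>). The upper
  bounds on \<open>\<tau>\<close> make this negligible against \<open>r L\<close> for second moments and against \<open>r sqrt L\<close> for
  first moments.

  At a coordinate with a nonzero true value \<open>\<theta>*\<close>, put \<open>t = sqrt ((2 + \<omega>) L)\<close>. A posterior draw
  either lies in the region \<open>\<bar>\<theta>\<bar> \<ge> \<bar>y\<bar>/2\<close>, where the prior density is at most a
  constant times its values near \<open>y\<close> and \<open>\<theta> - y\<close> behaves like Gaussian noise, or
  is shrunk towards \<open>0\<close>, and shrinkage by more than \<open>t\<close> is improbable by the second bound,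
  since the lower bound on \<open>\<tau>\<close> gives \<open>b \<ge> exp (-c L)\<close> with \<open>c L < t\<^sup>2/2\<close>. Hence the excess of \<open>\<bar>\<theta> - y\<bar>\<close>
  over \<open>t\<close> has a bounded second posterior moment, uniformly in \<open>y\<close> (\<open>post_mean_excess_bound\<close>).

  Since \<open>\<bar>\<theta> - \<theta>*\<bar> \<le> t + \<bar>y - \<theta>*\<bar> + max 0 (\<bar>\<theta> - y\<bar> - t)\<close> at the \<open>s\<close> nonzero coordinates, these contribute
  \<open>t sqrt s = sqrt (2 + \<omega>) sqrt (s L)\<close> to the \<open>L2\<close> distance, respectively
  \<open>s t\<close> to the \<open>L1\<close> distance. This is the first term of \<open>C1\<close> and of \<open>C2\<close>.
  The remaining errors, squared for \<open>L2\<close>, have expected sum \<open>O(s)\<close> over the nonzero coordinates, and over the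
  zero coordinates the null risk just described. Both are of smaller order than the slack left by the
  other terms of \<open>C1\<close> and \<open>C2\<close>, so Markov's inequality finishes the proof (\<open>posterior_deviation_le\<close>, \<open>expected_posterior_tendsto_0\<close>).
\<close>

section \<open>Coordinatewise Bayes formula\<close>

definition scaled_density :: "(real \<Rightarrow> real) \<Rightarrow> real \<Rightarrow> real \<Rightarrow> real" where
  "scaled_density f \<tau> \<theta> = (1 / \<tau>) * f (\<theta> / \<tau>)"

definition marginal :: "(real \<Rightarrow> real) \<Rightarrow> real \<Rightarrow> ennreal" where
  "marginal q y = (\<integral>\<^sup>+ \<theta>. ennreal (normal_density \<theta> 1 y * q \<theta>) \<partial>lborel)"

text \<open>Posterior expectation of \<open>g \<theta>\<close> for a single coordinate with prior density \<open>q\<close> and observation \<open>y\<close>.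
  As \<open>g\<close> takes values in \<^typ>\<open>ennreal\<close>, infinite moments cause no trouble.\<close>

definition post_mean :: "(real \<Rightarrow> real) \<Rightarrow> (real \<Rightarrow> ennreal) \<Rightarrow> real \<Rightarrow> ennreal" where
  "post_mean q g y =
     (\<integral>\<^sup>+ \<theta>. g \<theta> * ennreal (normal_density \<theta> 1 y * q \<theta>) \<partial>lborel) / marginal q y"

lemma normal_density_measurable_pair [measurable (raw)]:
  assumes [measurable]: "a \<in> borel_measurable M" "b \<in> borel_measurable M"
  shows "(\<lambda>x. normal_density (a x) 1 (b x)) \<in> borel_measurable M"
  unfolding normal_density_def by measurable

text \<open>The joint density is a product over coordinates, and so is the normalising constant; in the
  quotient every factor but the one of coordinate \<open>i\<close> cancels.\<close>

lemma posterior_coordinate: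
  fixes f :: "real \<Rightarrow> real"
  assumes f [measurable]: "f \<in> borel_measurable borel" and f0: "\<And>x. 0 \<le> f x" and \<tau>: "0 < \<tau>"
    and m0: "\<And>y. marginal (scaled_density f \<tau>) y \<noteq> 0"
    and m1: "\<And>y. marginal (scaled_density f \<tau>) y \<noteq> \<infinity>"
    and g [measurable]: "g \<in> borel_measurable borel" and i: "i < n"
  shows "(\<integral>\<^sup>+ \<theta>. g (\<theta> i) \<partial>posterior n f \<tau> y) = post_mean (scaled_density f \<tau>) g (y i)"
proof -
  let ?q = "scaled_density f \<tau>" and ?I = "{..<n}"
  let ?P = "\<Pi>\<^sub>M i\<in>?I. (lborel :: real measure)"
  let ?h = "\<lambda>j x. ennreal (normal_density x 1 (y j) * ?q x)"
  have q [measurable]: "?q \<in> borel_measurable borel"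
    unfolding scaled_density_def by measurable
  interpret product_sigma_finite "\<lambda>_::nat. lborel :: real measure" ..
  have meas_prior [measurable]: "(\<lambda>\<theta>. ennreal (\<Prod>i\<in>?I. (1/\<tau>) * f (\<theta> i / \<tau>))) \<in> borel_measurable ?P"
    by measurable
  have meas_lik [measurable]: "(\<lambda>\<theta>. ennreal (likelihood n \<theta> y)) \<in> borel_measurable ?P"
    unfolding likelihood_def by measurable
  have gm: "(\<lambda>\<theta>. g (\<theta> i)) \<in> borel_measurable ?P"
    using i by (auto intro!: measurable_compose[OF measurable_component_singleton[of i], where g=g])
  have joint: "ennreal (\<Prod>i\<in>?I. (1/\<tau>) * f (\<theta> i / \<tau>)) * ennreal (likelihood n \<theta> y) = (\<Prod>j\<in>?I. ?h j (\<theta> j))" for \<theta>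
    unfolding likelihood_def scaled_density_def using f0 \<tau>
    by (simp add: ennreal_mult[symmetric] prod_ennreal prod.distrib[symmetric] prod_nonneg mult_ac)
  have Z: "(\<integral>\<^sup>+ \<theta>'. ennreal (likelihood n \<theta>' y) \<partial>prior n f \<tau>) = (\<Prod>j\<in>?I. marginal ?q (y j))"
    unfolding prior_def marginal_def
    by (subst nn_integral_density, measurable, subst joint, subst product_nn_integral_prod, auto)
  let ?Z = "\<Prod>j\<in>?I. marginal ?q (y j)"
  have pm: "(\<lambda>\<theta>. ennreal (likelihood n \<theta> y) / ?Z) \<in> borel_measurable ?P"
    by measurable
  have "(\<integral>\<^sup>+ \<theta>. g (\<theta> i) \<partial>posterior n f \<tau> y) =
        (\<integral>\<^sup>+ \<theta>. ennreal (\<Prod>i\<in>?I. (1/\<tau>) * f (\<theta> i / \<tau>)) * (ennreal (likelihood n \<theta> y) / ?Z * g (\<theta> i)) \<partial>?P)"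
    unfolding posterior_def Z unfolding prior_def
    using pm gm by (simp add: nn_integral_density)
  also have "\<dots> = (\<integral>\<^sup>+ \<theta>. (\<Prod>j\<in>?I. ?h j (\<theta> j) * (if j = i then g (\<theta> j) else 1)) / ?Z \<partial>?P)"
  proof (intro nn_integral_cong)
    fix \<theta>
    have "(\<Prod>j\<in>?I. (if j = i then g (\<theta> j) else 1)) = g (\<theta> i)"
      using i by (simp add: prod.delta)
    then show "ennreal (\<Prod>i\<in>?I. (1/\<tau>) * f (\<theta> i / \<tau>)) * (ennreal (likelihood n \<theta> y) / ?Z * g (\<theta> i))
      = (\<Prod>j\<in>?I. ?h j (\<theta> j) * (if j = i then g (\<theta> j) else 1)) / ?Z"
      unfolding prod.distrib joint[symmetric] by (simp add: divide_ennreal_def mult_ac)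
  qed
  also have "\<dots> = (\<integral>\<^sup>+ \<theta>. (\<Prod>j\<in>?I. ?h j (\<theta> j) * (if j = i then g (\<theta> j) else 1)) \<partial>?P) / ?Z"
    by (rule nn_integral_divide) measurable
  also have "(\<integral>\<^sup>+ \<theta>. (\<Prod>j\<in>?I. ?h j (\<theta> j) * (if j = i then g (\<theta> j) else 1)) \<partial>?P)
      = (\<Prod>j\<in>?I. \<integral>\<^sup>+ x. ?h j x * (if j = i then g x else 1) \<partial>lborel)"
    by (rule product_nn_integral_prod) auto
  also have "\<dots> = (\<integral>\<^sup>+ x. ?h i x * g x \<partial>lborel) * (\<Prod>j\<in>?I - {i}. marginal ?q (y j))"
    using i by (subst prod.remove[of _ i]) (auto simp: marginal_def intro!: prod.cong)
  also have "?Z = marginal ?q (y i) * (\<Prod>j\<in>?I - {i}. marginal ?q (y j))"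
    using i by (subst prod.remove[of _ i]) auto
  also have "(\<integral>\<^sup>+ x. ?h i x * g x \<partial>lborel) * (\<Prod>j\<in>?I - {i}. marginal ?q (y j)) / \<dots>
     = post_mean ?q g (y i)"
    unfolding post_mean_def
    using m0 m1 by (subst divide_mult_eq) (auto simp: ennreal_prod_eq_top mult.commute)
  finally show ?thesis .
qed

lemma ennreal_measure_le_emeasure: "ennreal (measure M A) \<le> emeasure M A"
  by (cases "emeasure M A = \<top>") (simp_all add: emeasure_eq_ennreal_measure)

text \<open>A set outside the sigma-algebra has measure \<open>0\<close> by convention, so the bound is true for it as well.\<close>

lemma emeasure_le_nn_integral:
  assumes "\<And>x. x \<in> A \<Longrightarrow> 1 \<le> g x"
  shows "emeasure M A \<le> (\<integral>\<^sup>+ x. g x \<partial>M)"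
proof (cases "A \<in> sets M")
  case True
  then have "emeasure M A = (\<integral>\<^sup>+ x. indicator A x \<partial>M)" by simp
  also have "\<dots> \<le> (\<integral>\<^sup>+ x. g x \<partial>M)"
    using assms by (intro nn_integral_mono) (auto simp: indicator_def)
  finally show ?thesis .
qed (simp add: emeasure_notin_sets)

lemma nn_integral_data_law_coordinate:
  assumes [measurable]: "r \<in> borel_measurable borel" and i: "i < n"
  shows "(\<integral>\<^sup>+ y. r (y i) \<partial>data_law n \<theta>0) = (\<integral>\<^sup>+ x. ennreal (std_normal_density x) * r (\<theta>0 i + x) \<partial>lborel)"
proof -
  let ?N = "density lborel (\<lambda>x. ennreal (std_normal_density x))"
  interpret N: prob_space ?N by (rule prob_space_normal_density) simp
  have map [measurable]: "(\<lambda>\<epsilon>. \<lambda>i\<in>{..<n}. \<theta>0 i + \<epsilon> i) \<in> noise_law n \<rightarrow>\<^sub>M (\<Pi>\<^sub>M i\<in>{..<n}. lborel)"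
    unfolding noise_law_def by measurable
  have ri: "(\<lambda>y. r (y i)) \<in> borel_measurable (\<Pi>\<^sub>M i\<in>{..<n}. lborel)"
    using i by (auto intro!: measurable_compose[OF measurable_component_singleton[of i], where g=r])
  have "(\<integral>\<^sup>+ y. r (y i) \<partial>data_law n \<theta>0) = (\<integral>\<^sup>+ \<epsilon>. r (\<theta>0 i + \<epsilon> i) \<partial>noise_law n)"
    unfolding data_law_def using i ri by (subst nn_integral_distr[OF map]) simp_all
  also have "\<dots> = (\<integral>\<^sup>+ x. r (\<theta>0 i + x) \<partial>distr (noise_law n) ?N (\<lambda>\<epsilon>. \<epsilon> i))"
    using i unfolding noise_law_def by (subst nn_integral_distr) auto
  also have "distr (noise_law n) ?N (\<lambda>\<epsilon>. \<epsilon> i) = ?N"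
    unfolding noise_law_def using i by (intro distr_PiM_component) (auto intro: N.prob_space_axioms)
  also have "(\<integral>\<^sup>+ x. r (\<theta>0 i + x) \<partial>?N) = (\<integral>\<^sup>+ x. ennreal (std_normal_density x) * r (\<theta>0 i + x) \<partial>lborel)"
    by (subst nn_integral_density) auto
  finally show ?thesis .
qed

text \<open>Markov's inequality for the posterior, averaged over the data. If the event forces
  a sum of one-coordinate losses to reach \<open>\<kappa>\<close>, its expected posterior probability is at most the
  sum of the one-coordinate risks divided by \<open>\<kappa>\<close>. The losses may depend on the data.\<close>

lemma expected_posterior_le:
  fixes h :: "nat \<Rightarrow> real \<Rightarrow> real \<Rightarrow> ennreal"
  assumes f [measurable]: "f \<in> borel_measurable borel" and f0: "\<And>x. 0 \<le> f x" and \<tau>: "0 < \<tau>"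
    and m0: "\<And>y. marginal (scaled_density f \<tau>) y \<noteq> 0"
    and m1: "\<And>y. marginal (scaled_density f \<tau>) y \<noteq> \<infinity>"
    and h: "\<And>i. (\<lambda>(y, \<theta>). h i y \<theta>) \<in> borel_measurable (borel \<Otimes>\<^sub>M borel)"
    and \<kappa>: "0 < \<kappa>"
    and P: "\<And>\<theta> y. P \<theta> \<Longrightarrow> ennreal \<kappa> \<le> (\<Sum>i<n. h i (y i) (\<theta> i))"
    and \<beta>: "\<And>i. i < n \<Longrightarrow> 0 \<le> \<beta> i"
    and risk: "\<And>i. i < n \<Longrightarrow> (\<integral>\<^sup>+ x. ennreal (std_normal_density x) *
        post_mean (scaled_density f \<tau>) (h i (\<theta>0 i + x)) (\<theta>0 i + x) \<partial>lborel) \<le> ennreal (\<beta> i)"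
  shows "expected_posterior n f \<tau> \<theta>0 P \<le> (\<Sum>i<n. \<beta> i) / \<kappa>"
proof -
  let ?q = "scaled_density f \<tau>"
  let ?post = "posterior n f \<tau>"
  let ?A = "\<lambda>y. {\<theta> \<in> space (?post y). P \<theta>}"
  have [measurable]: "?q \<in> borel_measurable borel" unfolding scaled_density_def by measurable
  have hc [measurable]: "h i y \<in> borel_measurable borel" for i y
    using measurable_Pair2[OF h, of y i] by simp
  have hp [measurable (raw)]: "(\<lambda>x. h i (a x) (c x)) \<in> borel_measurable N"
    if "a \<in> borel_measurable N" "c \<in> borel_measurable N" for i a c and N :: "'z measure"
    using measurable_compose[OF measurable_Pair[OF that] h, of i] by simp
  have pm [measurable]: "(\<lambda>y. post_mean ?q (h i y) y) \<in> borel_measurable borel" for i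
    unfolding post_mean_def marginal_def by measurable
  have S0: "0 \<le> (\<Sum>i<n. \<beta> i) / \<kappa>" using \<beta> \<kappa> by (intro divide_nonneg_pos sum_nonneg) auto
  have le: "ennreal (measure (?post y) (?A y)) \<le> (\<Sum>i<n. post_mean ?q (h i (y i)) (y i)) / ennreal \<kappa>" for y
  proof -
    have sets_post: "sets (?post y) = sets (\<Pi>\<^sub>M i\<in>{..<n}. lborel)"
      by (simp add: posterior_def prior_def)
    have hm: "(\<lambda>\<theta>. h i (y i) (\<theta> i)) \<in> borel_measurable (?post y)" if "i < n" for i
      using that by (subst measurable_cong_sets[OF sets_post refl])
        (auto intro!: measurable_compose[OF measurable_component_singleton[of i], where g="h i (y i)"])
    have "ennreal (measure (?post y) (?A y)) \<le> emeasure (?post y) (?A y)"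
      by (rule ennreal_measure_le_emeasure)
    also have "\<dots> \<le> (\<integral>\<^sup>+ \<theta>. (\<Sum>i<n. h i (y i) (\<theta> i)) / ennreal \<kappa> \<partial>?post y)"
    proof (rule emeasure_le_nn_integral)
      fix \<theta> assume "\<theta> \<in> ?A y"
      then have "ennreal \<kappa> / ennreal \<kappa> \<le> (\<Sum>i<n. h i (y i) (\<theta> i)) / ennreal \<kappa>"
        by (intro divide_right_mono_ennreal P) auto
      then show "1 \<le> (\<Sum>i<n. h i (y i) (\<theta> i)) / ennreal \<kappa>"
        using \<kappa> by (simp add: divide_ennreal)
    qed
    also have "\<dots> = (\<Sum>i<n. \<integral>\<^sup>+ \<theta>. h i (y i) (\<theta> i) \<partial>?post y) / ennreal \<kappa>"
    proof (subst nn_integral_divide)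
      show "(\<lambda>\<theta>. \<Sum>i<n. h i (y i) (\<theta> i)) \<in> borel_measurable (?post y)"
        using hm by (intro borel_measurable_sum) auto
    qed (subst nn_integral_sum, use hm in auto)
    also have "(\<Sum>i<n. \<integral>\<^sup>+ \<theta>. h i (y i) (\<theta> i) \<partial>?post y) = (\<Sum>i<n. post_mean ?q (h i (y i)) (y i))"
      by (intro sum.cong refl posterior_coordinate f f0 \<tau> m0 m1 hc) auto
    finally show ?thesis .
  qed
  \<comment> \<open>The Bochner integral of a non-integrable function is \<open>0\<close>, which satisfies the bound.\<close>
  show ?thesis
  proof (cases "integrable (data_law n \<theta>0) (\<lambda>y. measure (?post y) (?A y))")
    case False
    then show ?thesis using S0 by (simp add: expected_posterior_def not_integrable_integral_eq)
  next
    case True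
    have ym: "(\<lambda>y. post_mean ?q (h i (y i)) (y i)) \<in> borel_measurable (data_law n \<theta>0)" if "i < n" for i
      unfolding data_law_def measurable_distr_eq1 using that
      by (auto intro!: measurable_compose[OF measurable_component_singleton[of i], where g="\<lambda>y. post_mean ?q (h i y) y"])
    have "ennreal (expected_posterior n f \<tau> \<theta>0 P) = (\<integral>\<^sup>+ y. ennreal (measure (?post y) (?A y)) \<partial>data_law n \<theta>0)"
      unfolding expected_posterior_def by (subst nn_integral_eq_integral[OF True]) auto
    also have "\<dots> \<le> (\<integral>\<^sup>+ y. (\<Sum>i<n. post_mean ?q (h i (y i)) (y i)) / ennreal \<kappa> \<partial>data_law n \<theta>0)"
      by (intro nn_integral_mono le)
    also have "\<dots> = (\<Sum>i<n. \<integral>\<^sup>+ y. post_mean ?q (h i (y i)) (y i) \<partial>data_law n \<theta>0) / ennreal \<kappa>"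
    proof (subst nn_integral_divide)
      show "(\<lambda>y. \<Sum>i<n. post_mean ?q (h i (y i)) (y i)) \<in> borel_measurable (data_law n \<theta>0)"
        using ym by (intro borel_measurable_sum) auto
    qed (subst nn_integral_sum, use ym in auto)
    also have "\<dots> \<le> (\<Sum>i<n. ennreal (\<beta> i)) / ennreal \<kappa>"
    proof (intro divide_right_mono_ennreal sum_mono)
      fix i assume "i \<in> {..<n}"
      then show "(\<integral>\<^sup>+ y. post_mean ?q (h i (y i)) (y i) \<partial>data_law n \<theta>0) \<le> ennreal (\<beta> i)"
        using nn_integral_data_law_coordinate[OF pm[of i], of i n \<theta>0] risk[of i] by simp
    qed
    also have "\<dots> = ennreal ((\<Sum>i<n. \<beta> i) / \<kappa>)"
    proof -
      have "(\<Sum>i<n. ennreal (\<beta> i)) = ennreal (\<Sum>i<n. \<beta> i)" using \<beta> by (intro sum_ennreal) auto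
      moreover have "0 \<le> (\<Sum>i<n. \<beta> i)" using \<beta> by (intro sum_nonneg) auto
      ultimately show ?thesis using \<kappa> by (simp add: divide_ennreal)
    qed
    finally show ?thesis using S0 by (simp add: ennreal_le_iff)
  qed
qed

section \<open>Gaussian estimates\<close>

lemma normal_density_swap: "normal_density \<theta> 1 y = normal_density y 1 \<theta>"
  by (simp add: normal_density_def power2_commute)

lemma normal_density_le_1: "normal_density \<theta> 1 y \<le> 1"
proof -
  have "1 \<le> sqrt (2 * pi)" using pi_gt3 by simp
  then have "1 / sqrt (2 * pi) \<le> 1" by simp
  moreover have "exp (- (y - \<theta>)\<^sup>2 / 2) \<le> 1" by simp
  ultimately have "1 / sqrt (2 * pi) * exp (- (y - \<theta>)\<^sup>2 / 2) \<le> 1 * 1"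
    by (rule mult_mono) auto
  then show ?thesis unfolding normal_density_def by simp
qed

lemma nn_integral_normal_density:
  "0 < \<sigma> \<Longrightarrow> (\<integral>\<^sup>+ x. ennreal (normal_density \<mu> \<sigma> x) \<partial>lborel) = 1"
  by (subst nn_integral_eq_integral) auto

lemma nn_integral_normal_second_moment:
  "(\<integral>\<^sup>+ x. ennreal ((x - \<mu>)\<^sup>2 * normal_density \<mu> 1 x) \<partial>lborel) = 1"
proof -
  have "has_bochner_integral lborel (\<lambda>x. normal_density \<mu> 1 x * (x - \<mu>)^(2*1)) (fact (2*1) / ((2/1\<^sup>2)^1 * fact 1))"
    by (rule normal_moment_even) simp
  then have *: "has_bochner_integral lborel (\<lambda>x. (x - \<mu>)\<^sup>2 * normal_density \<mu> 1 x) 1"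
    by (simp add: mult.commute)
  then show ?thesis
    by (subst nn_integral_eq_integral) (auto simp: has_bochner_integral_iff)
qed

lemma sq_times_exp_le: "x\<^sup>2 * exp (- (x\<^sup>2 / c)) \<le> c" if "0 < c" for x c :: real
proof -
  have "x\<^sup>2 / c \<le> exp (x\<^sup>2 / c)"
    using exp_ge_add_one_self[of "x\<^sup>2/c"] by linarith
  then have "x\<^sup>2 \<le> c * exp (x\<^sup>2 / c)" using that by (simp add: field_simps)
  then have "x\<^sup>2 * exp (- (x\<^sup>2 / c)) \<le> c * exp (x\<^sup>2 / c) * exp (- (x\<^sup>2 / c))"
    by (intro mult_right_mono) auto
  then show ?thesis by (simp add: mult.assoc exp_add[symmetric])
qed

text \<open>Splitting \<open>exp (-y\<^sup>2/2)\<close> into three Gaussian factors: one absorbs \<open>y\<^sup>2\<close>, one yields the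
  small factor \<open>exp (-T\<^sup>2/4)\<close>, and the last one stays integrable.\<close>

lemma sq_times_std_normal_density_le:
  assumes "T \<le> \<bar>y\<bar>" "0 \<le> T"
  shows "y\<^sup>2 * std_normal_density y \<le> 16 * exp (- T\<^sup>2 / 4) * normal_density 0 2 y"
proof -
  have T: "T\<^sup>2 \<le> y\<^sup>2" using assms power_mono[of T "\<bar>y\<bar>" 2] by simp
  have "y\<^sup>2 * exp (- y\<^sup>2 / 2) = (y\<^sup>2 * exp (- (y\<^sup>2 / 8))) * exp (- y\<^sup>2 / 4) * exp (- y\<^sup>2 / 8)"
    by (simp add: mult.assoc exp_add[symmetric])
  also have "\<dots> \<le> 8 * exp (- T\<^sup>2 / 4) * exp (- y\<^sup>2 / 8)"
    using sq_times_exp_le[of 8 y] T by (intro mult_right_mono mult_mono) auto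
  finally have "y\<^sup>2 * exp (- y\<^sup>2 / 2) / sqrt (2 * pi) \<le> 8 * exp (- T\<^sup>2 / 4) * exp (- y\<^sup>2 / 8) / sqrt (2 * pi)"
    by (rule divide_right_mono) simp
  moreover have "sqrt (2 * pi * 4) = 2 * sqrt (2 * pi)"
    using real_sqrt_mult[of "2 * pi" 4] by (simp only: real_sqrt_four mult.commute)
  ultimately show ?thesis unfolding normal_density_def by simp
qed

text \<open>Chebyshev's inequality: reaching the window costs a deviation of at least \<open>\<bar>\<theta>\<bar>/2\<close> from the mean \<open>\<theta>\<close>.\<close>

lemma normal_window_prob_le:
  assumes "2 * T < \<bar>\<theta>\<bar>" "0 \<le> T"
  shows "(\<integral>\<^sup>+ y. ennreal (normal_density \<theta> 1 y) * indicator {-T..T} y \<partial>lborel) \<le> ennreal (4 / \<theta>\<^sup>2)"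
proof -
  have \<theta>: "0 < \<theta>\<^sup>2" using assms by auto
  have "(\<integral>\<^sup>+ y. ennreal (normal_density \<theta> 1 y) * indicator {-T..T} y \<partial>lborel)
      \<le> (\<integral>\<^sup>+ y. ennreal (4 / \<theta>\<^sup>2) * ennreal ((y - \<theta>)\<^sup>2 * normal_density \<theta> 1 y) \<partial>lborel)"
  proof (intro nn_integral_mono)
    fix y
    have "normal_density \<theta> 1 y \<le> 4 / \<theta>\<^sup>2 * ((y - \<theta>)\<^sup>2 * normal_density \<theta> 1 y)" if y: "y \<in> {-T..T}"
    proof -
      have "\<bar>\<theta>\<bar> \<le> 2 * \<bar>y - \<theta>\<bar>" proof -
        have "\<bar>y\<bar> \<le> T" "\<bar>\<theta>\<bar> \<le> \<bar>y - \<theta>\<bar> + \<bar>y\<bar>" using y by auto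
        moreover have "a \<le> 2 * c" if "b \<le> T" "a \<le> c + b" "2 * T < a" for a b c :: real
          using that by linarith
        ultimately show ?thesis using assms by blast
      qed
      then have "\<bar>\<theta>\<bar>\<^sup>2 \<le> (2 * \<bar>y - \<theta>\<bar>)\<^sup>2" by (intro power_mono) auto
      then have "1 \<le> 4 / \<theta>\<^sup>2 * (y - \<theta>)\<^sup>2" using \<theta> by (simp add: power_mult_distrib field_simps)
      then have "1 * normal_density \<theta> 1 y \<le> 4 / \<theta>\<^sup>2 * (y - \<theta>)\<^sup>2 * normal_density \<theta> 1 y"
        by (intro mult_right_mono) auto
      then show ?thesis by simp
    qed
    then show "ennreal (normal_density \<theta> 1 y) * indicator {-T..T} y \<le> ennreal (4 / \<theta>\<^sup>2) * ennreal ((y - \<theta>)\<^sup>2 * normal_density \<theta> 1 y)"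
      by (auto simp: indicator_def ennreal_mult[symmetric] intro!: ennreal_leI)
  qed
  also have "\<dots> = ennreal (4 / \<theta>\<^sup>2)"
    by (subst nn_integral_cmult) (auto simp: nn_integral_normal_second_moment)
  finally show ?thesis .
qed

lemma power_le_square_of_ge_1: "1 \<le> k \<Longrightarrow> k \<le> 2 \<Longrightarrow> 1 \<le> x \<Longrightarrow> x ^ k \<le> x\<^sup>2" for x :: real and k :: nat
  by (rule power_increasing) auto

section \<open>One coordinate under a prior with a spike and polynomial tails\<close>

text \<open>What the argument uses of the scaled density: mass on both sides of \<open>0\<close> that does not vanish with \<open>\<tau>\<close>,
  and polynomial tails of weight \<open>b\<close>, which stands for \<open>\<tau> powr (\<alpha> - 1)\<close>. The constants \<open>p0\<close>, \<open>D\<close>, \<open>K1\<close>, \<open>K2\<close> do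
  not depend on \<open>\<tau>\<close>, which makes every bound below uniform along the asymptotics.\<close>

locale heavy_tailed_prior =
  fixes q :: "real \<Rightarrow> real" and \<alpha> b p0 D K1 K2 :: real
  assumes q_meas [measurable]: "q \<in> borel_measurable borel"
    and q_nonneg: "0 \<le> q \<theta>"
    and q_total: "(\<integral>\<^sup>+ \<theta>. ennreal (q \<theta>) \<partial>lborel) = 1"
    and mass_right: "ennreal p0 \<le> (\<integral>\<^sup>+ \<theta>. ennreal (q \<theta>) * indicator {0<..<1} \<theta> \<partial>lborel)"
    and mass_left: "ennreal p0 \<le> (\<integral>\<^sup>+ \<theta>. ennreal (q \<theta>) * indicator {-1<..<0} \<theta> \<partial>lborel)"
    and tail_mass: "0 < \<delta> \<Longrightarrow> (\<integral>\<^sup>+ \<theta>. ennreal (q \<theta>) * indicator {\<theta>. \<delta> < \<bar>\<theta>\<bar>} \<theta> \<partial>lborel)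
           \<le> ennreal (D * b * \<delta> powr (1 - \<alpha>))"
    and tail_lower: "1/2 \<le> \<bar>\<theta>\<bar> \<Longrightarrow> K1 * b * \<bar>\<theta>\<bar> powr (- \<alpha>) \<le> q \<theta>"
    and tail_upper: "1/2 \<le> \<bar>\<theta>\<bar> \<Longrightarrow> q \<theta> \<le> K2 * b * \<bar>\<theta>\<bar> powr (- \<alpha>)"
    and p0_pos: "0 < p0" and K1_pos: "0 < K1" and K2_pos: "0 < K2" and b_pos: "0 < b"
    and D_nonneg: "0 \<le> D" and \<alpha>_gt1: "1 < \<alpha>"
begin

definition c_origin :: real where "c_origin = exp (-1/2) * p0"
definition c_tail :: real where "c_tail = std_normal_density (1/2) * K1 * 2 powr (- \<alpha>)"

lemma c_origin_pos: "0 < c_origin" and c_tail_pos: "0 < c_tail"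
  using p0_pos K1_pos by (auto simp: c_origin_def c_tail_def normal_density_pos)

lemma marginal_finite: "marginal q y < \<infinity>"
proof -
  have "marginal q y \<le> (\<integral>\<^sup>+ \<theta>. ennreal (q \<theta>) \<partial>lborel)"
    unfolding marginal_def
    using normal_density_le_1 q_nonneg by (intro nn_integral_mono ennreal_leI) (simp add: mult_left_le_one_le)
  then show ?thesis using q_total by (simp add: le_less_trans)
qed

text \<open>On \<open>(0,1)\<close> when \<open>y \<ge> 0\<close>, and on \<open>(-1,0)\<close> when \<open>y < 0\<close>, the likelihood \<open>\<phi>(y - \<theta>)\<close> is at least
  \<open>exp (-1/2) \<phi>(y)\<close>, because the cross term \<open>y \<theta>\<close> has a favourable sign. This is why mass on both
  sides of \<open>0\<close> is required.\<close>

lemma marginal_ge_at_origin: "ennreal (c_origin * std_normal_density y) \<le> marginal q y"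
proof -
  have key: "ennreal (c_origin * std_normal_density y) \<le> marginal q y"
    if A: "A \<in> sets borel" and mass: "ennreal p0 \<le> (\<integral>\<^sup>+ \<theta>. ennreal (q \<theta>) * indicator A \<theta> \<partial>lborel)"
      and sgn: "\<And>\<theta>. \<theta> \<in> A \<Longrightarrow> 0 \<le> y * \<theta> \<and> \<theta>\<^sup>2 \<le> 1" for A
  proof -
    have "exp (-1/2) * std_normal_density y \<le> normal_density \<theta> 1 y" if "\<theta> \<in> A" for \<theta>
    proof -
      have "-1/2 + - y\<^sup>2 / 2 \<le> - (y - \<theta>)\<^sup>2 / 2"
        using sgn[OF that] by (simp add: power2_eq_square algebra_simps)
      then have "exp (-1/2) * exp (- y\<^sup>2 / 2) \<le> exp (- (y - \<theta>)\<^sup>2 / 2)"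
        unfolding exp_add[symmetric] by (subst exp_le_cancel_iff)
      then show ?thesis unfolding normal_density_def by (simp add: divide_right_mono)
    qed
    then have "(\<integral>\<^sup>+ \<theta>. ennreal (exp (-1/2) * std_normal_density y) * (ennreal (q \<theta>) * indicator A \<theta>) \<partial>lborel) \<le> marginal q y"
      unfolding marginal_def using q_nonneg
      by (intro nn_integral_mono) (auto simp: indicator_def ennreal_mult[symmetric] intro!: ennreal_leI mult_right_mono)
    also have "(\<integral>\<^sup>+ \<theta>. ennreal (exp (-1/2) * std_normal_density y) * (ennreal (q \<theta>) * indicator A \<theta>) \<partial>lborel)
        = ennreal (exp (-1/2) * std_normal_density y) * (\<integral>\<^sup>+ \<theta>. ennreal (q \<theta>) * indicator A \<theta> \<partial>lborel)"
      using A by (intro nn_integral_cmult) auto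
    finally have le: "\<dots> \<le> marginal q y" .
    have "ennreal (c_origin * std_normal_density y) = ennreal (exp (-1/2) * std_normal_density y) * ennreal p0"
      using p0_pos by (simp add: c_origin_def ennreal_mult[symmetric] mult_ac)
    also have "\<dots> \<le> ennreal (exp (-1/2) * std_normal_density y) * (\<integral>\<^sup>+ \<theta>. ennreal (q \<theta>) * indicator A \<theta> \<partial>lborel)"
      by (intro mult_left_mono mass) auto
    also note le
    finally show ?thesis .
  qed
  show ?thesis
  proof (cases "0 \<le> y")
    case True
    then show ?thesis by (intro key[OF _ mass_right]) (auto simp: abs_square_le_1)
  next
    case False
    then show ?thesis by (intro key[OF _ mass_left]) (auto simp: abs_square_le_1 mult_nonpos_nonpos)
  qed
qed

lemma marginal_pos: "0 < marginal q y"
proof -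
  have "0 < ennreal (c_origin * std_normal_density y)"
    using c_origin_pos by (simp add: normal_density_pos)
  then show ?thesis using marginal_ge_at_origin by (rule less_le_trans)
qed

text \<open>Prior mass within distance \<open>1/2\<close> of \<open>y\<close>, where \<open>\<bar>\<theta>\<bar> \<le> 2 \<bar>y\<bar>\<close> and the tail lower bound applies.\<close>

lemma marginal_ge_tail:
  assumes "1 \<le> \<bar>y\<bar>"
  shows "ennreal (c_tail * b * \<bar>y\<bar> powr (- \<alpha>)) \<le> marginal q y"
proof -
  let ?A = "{y - 1/2 .. y + 1/2}"
  have "c_tail * b * \<bar>y\<bar> powr (- \<alpha>) \<le> normal_density \<theta> 1 y * q \<theta>" if "\<theta> \<in> ?A" for \<theta>
  proof -
    have *: "\<bar>y\<bar> / 2 \<le> \<bar>\<theta>\<bar>" "\<bar>\<theta>\<bar> \<le> 2 * \<bar>y\<bar>" "\<bar>y - \<theta>\<bar> \<le> 1/2"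
      using that assms by (auto simp: abs_if split: if_splits)
    have 1: "std_normal_density (1/2) \<le> normal_density \<theta> 1 y"
    proof -
      have "\<bar>y - \<theta>\<bar>\<^sup>2 \<le> (1/2)\<^sup>2" using *(3) by (intro power_mono) auto
      then show ?thesis unfolding normal_density_def by (auto intro!: divide_right_mono)
    qed
    have "(2 * \<bar>y\<bar>) powr (- \<alpha>) \<le> \<bar>\<theta>\<bar> powr (- \<alpha>)"
      using * assms \<alpha>_gt1 by (intro powr_mono2') auto
    then have "K1 * b * (2 * \<bar>y\<bar>) powr (- \<alpha>) \<le> K1 * b * \<bar>\<theta>\<bar> powr (- \<alpha>)"
      using K1_pos b_pos by (intro mult_left_mono) auto
    also have "\<dots> \<le> q \<theta>" using * assms by (intro tail_lower) auto
    finally have "K1 * b * (2 * \<bar>y\<bar>) powr (- \<alpha>) \<le> q \<theta>" .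
    then have "std_normal_density (1/2) * (K1 * b * (2 * \<bar>y\<bar>) powr (- \<alpha>)) \<le> normal_density \<theta> 1 y * q \<theta>"
      using 1 K1_pos b_pos by (intro mult_mono) auto
    then show ?thesis using assms by (simp add: c_tail_def powr_mult mult_ac)
  qed
  then have "(\<integral>\<^sup>+ \<theta>. ennreal (c_tail * b * \<bar>y\<bar> powr (- \<alpha>)) * indicator ?A \<theta> \<partial>lborel) \<le> marginal q y"
    unfolding marginal_def by (intro nn_integral_mono) (auto simp: indicator_def intro!: ennreal_leI)
  then show ?thesis by (simp add: nn_integral_cmult_indicator)
qed

lemma post_mean_leI:
  assumes "(\<integral>\<^sup>+ \<theta>. g \<theta> * ennreal (normal_density \<theta> 1 y * q \<theta>) \<partial>lborel) \<le> C * marginal q y"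
  shows "post_mean q g y \<le> C"
proof -
  have "post_mean q g y \<le> C * marginal q y / marginal q y"
    unfolding post_mean_def by (rule divide_right_mono_ennreal[OF assms])
  also have "\<dots> = C"
    using marginal_pos[of y] marginal_finite[of y] by (subst mult_divide_eq_ennreal) auto
  finally show ?thesis .
qed

text \<open>One summand for each of the three cases of the next bound: shrinkage towards \<open>0\<close>, prior tail, and \<open>\<bar>y\<bar> < 1\<close>.\<close>

definition excess_const :: "real \<Rightarrow> real" where
  "excess_const B = B / c_tail + K2 * 2 powr \<alpha> / c_tail + 1 / (c_origin * std_normal_density 1)"

lemma excess_const_nonneg: "0 \<le> B \<Longrightarrow> 0 \<le> excess_const B"
  unfolding excess_const_def using c_tail_pos c_origin_pos K2_pos
  by (intro add_nonneg_nonneg divide_nonneg_pos mult_pos_pos mult_nonneg_nonneg)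
     (auto simp: normal_density_pos)

text \<open>The excess of \<open>u = \<bar>\<theta> - y\<bar>\<close> over the threshold \<open>t\<close> has a second posterior moment bounded uniformly in \<open>y\<close>.
  For \<open>\<bar>\<theta>\<bar> \<ge> \<bar>y\<bar>/2\<close> the prior density is comparable with its lower bound near \<open>y\<close>, so the Gaussian
  second moment decides. For \<open>\<bar>\<theta>\<bar> < \<bar>y\<bar>/2\<close> one has \<open>\<bar>y\<bar> \<le> 2 u\<close>, and \<open>u \<ge> t\<close> gives
  \<open>exp (-\<kappa> u\<^sup>2) \<le> b\<close>, hence \<open>m(y) \<ge> const exp (-\<kappa> u\<^sup>2) (2 u) powr (-\<alpha>)\<close>. The constant \<open>B\<close> measures how
  \<open>u\<^sup>2 exp (-u\<^sup>2/2)\<close> compares with this.\<close>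

lemma post_mean_excess_bound:
  assumes t: "0 \<le> t" and b_ge: "exp (- \<kappa> * t\<^sup>2) \<le> b" and \<kappa>: "0 \<le> \<kappa>"
    and B: "\<And>u. 0 \<le> u \<Longrightarrow> u\<^sup>2 * (2 * u) powr \<alpha> * exp (- (1/2 - \<kappa>) * u\<^sup>2) \<le> B"
  shows "post_mean q (\<lambda>\<theta>. ennreal ((max 0 (\<bar>\<theta> - y\<bar> - t))\<^sup>2)) y
     \<le> ennreal (excess_const B)"
proof -
  let ?m = "marginal q y" and ?w = "\<lambda>\<theta>. (max 0 (\<bar>\<theta> - y\<bar> - t))\<^sup>2"
  let ?N = "\<integral>\<^sup>+ \<theta>. ennreal (?w \<theta>) * ennreal (normal_density \<theta> 1 y * q \<theta>) \<partial>lborel"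
  define d where "d = c_origin * std_normal_density 1"
  have d: "0 < d" using c_origin_pos by (simp add: d_def normal_density_pos)
  have B0: "0 \<le> B" using B[of 0] by simp
  have w_le: "?w \<theta> \<le> (\<theta> - y)\<^sup>2" for \<theta>
    using t by (auto simp: max_def abs_le_square_iff[symmetric])
  have w_norm: "?w \<theta> * normal_density \<theta> 1 y \<le> (\<theta> - y)\<^sup>2 * normal_density y 1 \<theta>" for \<theta>
    using w_le[of \<theta>] by (simp add: normal_density_swap[of \<theta>] mult_right_mono)
  have "?N \<le> ennreal (B / c_tail + K2 * 2 powr \<alpha> / c_tail + 1 / d) * ?m"
  proof (cases "1 \<le> \<bar>y\<bar>")
    case False
    have sq: "(\<theta> - y)\<^sup>2 * normal_density y 1 \<theta> \<le> 1" for \<theta>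
    proof -
      have "(\<theta> - y)\<^sup>2 * exp (- ((\<theta> - y)\<^sup>2 / 2)) \<le> 2" by (rule sq_times_exp_le) simp
      moreover have "2 \<le> sqrt (2 * pi)" using pi_gt3 by (intro real_le_rsqrt) simp
      ultimately show ?thesis unfolding normal_density_def by (simp add: field_simps)
    qed
    have "?N \<le> (\<integral>\<^sup>+ \<theta>. ennreal (q \<theta>) \<partial>lborel)"
    proof (intro nn_integral_mono)
      fix \<theta>
      have "?w \<theta> * normal_density \<theta> 1 y \<le> 1" using w_norm[of \<theta>] sq[of \<theta>] by linarith
      then have "?w \<theta> * (normal_density \<theta> 1 y * q \<theta>) \<le> q \<theta>"
        using q_nonneg[of \<theta>] by (simp add: mult.assoc[symmetric] mult_left_le_one_le)
      then show "ennreal (?w \<theta>) * ennreal (normal_density \<theta> 1 y * q \<theta>) \<le> ennreal (q \<theta>)"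
        using q_nonneg[of \<theta>] by (simp add: ennreal_mult[symmetric] ennreal_leI)
    qed
    also have "\<dots> = ennreal (1 / d * d)" using q_total d by simp
    also have "\<dots> = ennreal (1/d) * ennreal d" using d by (intro ennreal_mult) auto
    also have "\<dots> \<le> ennreal (1/d) * ?m"
    proof (intro mult_left_mono)
      have "y\<^sup>2 \<le> 1" using False by (simp add: abs_square_le_1)
      then have "std_normal_density 1 \<le> std_normal_density y"
        unfolding normal_density_def by (auto intro!: divide_right_mono)
      then have "ennreal d \<le> ennreal (c_origin * std_normal_density y)"
        using c_origin_pos unfolding d_def by (intro ennreal_leI mult_left_mono) auto
      also have "\<dots> \<le> ?m" by (rule marginal_ge_at_origin)
      finally show "ennreal d \<le> ?m" .
    qed simp
    also have "\<dots> \<le> ennreal (B / c_tail + K2 * 2 powr \<alpha> / c_tail + 1 / d) * ?m"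
      using B0 c_tail_pos K2_pos by (intro mult_right_mono ennreal_leI) auto
    finally show ?thesis .
  next
    case True
    define l where "l = c_tail * b * \<bar>y\<bar> powr (- \<alpha>)"
    have l: "0 < l" using c_tail_pos b_pos True by (simp add: l_def)
    have lm: "ennreal l \<le> ?m" unfolding l_def by (rule marginal_ge_tail[OF True])
    let ?c = "K2 * 2 powr \<alpha> / c_tail"
    have pw: "?w \<theta> * (normal_density \<theta> 1 y * q \<theta>) \<le> B / c_tail * l * q \<theta> + ?c * l * ((\<theta> - y)\<^sup>2 * normal_density y 1 \<theta>)" for \<theta>
    proof (cases "\<bar>y\<bar> / 2 \<le> \<bar>\<theta>\<bar>")
      case far: True
      have "\<bar>\<theta>\<bar> powr (- \<alpha>) \<le> (\<bar>y\<bar> / 2) powr (- \<alpha>)"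
        using far True \<alpha>_gt1 by (intro powr_mono2') auto
      also have "\<dots> = 2 powr \<alpha> * \<bar>y\<bar> powr (- \<alpha>)"
        using True by (simp add: powr_divide powr_minus field_simps)
      finally have *: "\<bar>\<theta>\<bar> powr (- \<alpha>) \<le> 2 powr \<alpha> * \<bar>y\<bar> powr (- \<alpha>)" .
      have "q \<theta> \<le> K2 * b * \<bar>\<theta>\<bar> powr (- \<alpha>)"
        using far True by (intro tail_upper) auto
      also have "\<dots> \<le> K2 * b * (2 powr \<alpha> * \<bar>y\<bar> powr (- \<alpha>))"
        using * K2_pos b_pos by (intro mult_left_mono) auto
      also have "\<dots> = ?c * l" using c_tail_pos by (simp add: l_def)
      finally have "q \<theta> \<le> ?c * l" .
      then have "(?w \<theta> * normal_density \<theta> 1 y) * q \<theta> \<le> ((\<theta> - y)\<^sup>2 * normal_density y 1 \<theta>) * (?c * l)"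
        by (rule mult_mono[OF w_norm[of \<theta>]]) (use q_nonneg[of \<theta>] in auto)
      moreover have "0 \<le> B / c_tail * l * q \<theta>" using B0 c_tail_pos l q_nonneg by simp
      ultimately show ?thesis by (simp add: mult_ac)
    next
      case near: False
      define u where "u = \<bar>\<theta> - y\<bar>"
      have u: "\<bar>y\<bar> / 2 \<le> u" "0 < u" using near True unfolding u_def by linarith+
      have "?w \<theta> * normal_density \<theta> 1 y \<le> B / c_tail * l"
      proof (cases "t \<le> u")
        case False
        then have "?w \<theta> = 0" by (simp add: u_def)
        then show ?thesis using B0 c_tail_pos l by simp
      next
        case tu: True
        have "exp (- \<kappa> * u\<^sup>2) \<le> exp (- \<kappa> * t\<^sup>2)"
          using tu t \<kappa> by (auto intro!: mult_left_mono power_mono)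
        then have bu: "exp (- \<kappa> * u\<^sup>2) \<le> b" using b_ge by linarith
        have yu: "(2 * u) powr (- \<alpha>) \<le> \<bar>y\<bar> powr (- \<alpha>)"
          using u True \<alpha>_gt1 by (intro powr_mono2') auto
        have nd: "normal_density \<theta> 1 y \<le> exp (- u\<^sup>2 / 2)"
        proof -
          have "1 \<le> sqrt (2 * pi)" using pi_gt3 by simp
          then have "exp (- (y - \<theta>)\<^sup>2 / 2) / sqrt (2 * pi) \<le> exp (- (y - \<theta>)\<^sup>2 / 2) / 1"
            by (intro divide_left_mono) auto
          then show ?thesis unfolding normal_density_def u_def by (simp add: power2_commute)
        qed
        have "?w \<theta> * normal_density \<theta> 1 y \<le> u\<^sup>2 * exp (- u\<^sup>2 / 2)"
          using w_le[of \<theta>] by (intro mult_mono[OF _ nd]) (auto simp: u_def)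
        also have "\<dots> = (u\<^sup>2 * (2 * u) powr \<alpha> * exp (- (1/2 - \<kappa>) * u\<^sup>2)) * (exp (- \<kappa> * u\<^sup>2) * (2 * u) powr (- \<alpha>))"
        proof -
          have 1: "exp (- u\<^sup>2 / 2) = exp (- (1/2 - \<kappa>) * u\<^sup>2) * exp (- \<kappa> * u\<^sup>2)"
            unfolding exp_add[symmetric] by (simp add: algebra_simps)
          have 2: "(2 * u) powr \<alpha> * (2 * u) powr (- \<alpha>) = 1"
            using u by (simp add: powr_add[symmetric])
          have "u\<^sup>2 * exp (- u\<^sup>2 / 2) = u\<^sup>2 * (exp (- (1/2 - \<kappa>) * u\<^sup>2) * exp (- \<kappa> * u\<^sup>2)) * ((2 * u) powr \<alpha> * (2 * u) powr (- \<alpha>))"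
            unfolding 1 2 by (rule mult_1_right[symmetric])
          then show ?thesis by (simp only: mult_ac)
        qed
        also have "\<dots> \<le> B * (b * \<bar>y\<bar> powr (- \<alpha>))"
          using u bu yu b_pos B0 by (intro mult_mono[OF B[of u]] mult_mono[OF bu yu]) auto
        also have "\<dots> = B / c_tail * l" using c_tail_pos by (simp add: l_def)
        finally show ?thesis .
      qed
      then have "(?w \<theta> * normal_density \<theta> 1 y) * q \<theta> \<le> B / c_tail * l * q \<theta>"
        using q_nonneg[of \<theta>] by (rule mult_right_mono)
      moreover have "0 \<le> ?c * l * ((\<theta> - y)\<^sup>2 * normal_density y 1 \<theta>)"
        using c_tail_pos l K2_pos by simp
      ultimately show ?thesis by (simp add: mult_ac)
    qed
    have "?N \<le> (\<integral>\<^sup>+ \<theta>. ennreal (B / c_tail * l) * ennreal (q \<theta>) + ennreal (?c * l) * ennreal ((\<theta> - y)\<^sup>2 * normal_density y 1 \<theta>) \<partial>lborel)"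
    proof (intro nn_integral_mono)
      fix \<theta>
      have nn: "0 \<le> B / c_tail * l" "0 \<le> ?c * l" using B0 c_tail_pos l K2_pos by auto
      have "ennreal (?w \<theta>) * ennreal (normal_density \<theta> 1 y * q \<theta>) = ennreal (?w \<theta> * (normal_density \<theta> 1 y * q \<theta>))"
        using q_nonneg by (simp add: ennreal_mult)
      also have "\<dots> \<le> ennreal (B / c_tail * l * q \<theta> + ?c * l * ((\<theta> - y)\<^sup>2 * normal_density y 1 \<theta>))"
        by (rule ennreal_leI[OF pw])
      also have "\<dots> = ennreal (B / c_tail * l) * ennreal (q \<theta>) + ennreal (?c * l) * ennreal ((\<theta> - y)\<^sup>2 * normal_density y 1 \<theta>)"
        using nn q_nonneg[of \<theta>] by (simp only: ennreal_plus ennreal_mult mult_nonneg_nonneg normal_density_nonneg zero_le_power2)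
      finally show "ennreal (?w \<theta>) * ennreal (normal_density \<theta> 1 y * q \<theta>) \<le> \<dots>" .
    qed
    also have "\<dots> = ennreal (B / c_tail * l) + ennreal (?c * l)"
      by (subst nn_integral_add) (auto simp: nn_integral_cmult q_total nn_integral_normal_second_moment)
    also have "\<dots> = ennreal (B / c_tail + ?c) * ennreal l"
      using B0 c_tail_pos l K2_pos by (simp add: ennreal_mult[symmetric] ennreal_plus[symmetric] distrib_right del: ennreal_plus)
    also have "\<dots> \<le> ennreal (B / c_tail + ?c + 1 / d) * ?m"
      using lm d by (intro mult_mono ennreal_leI) auto
    finally show ?thesis .
  qed
  then show ?thesis unfolding d_def excess_const_def[symmetric] by (rule post_mean_leI)
qed

end

context heavy_tailed_prior
begin

text \<open>A draw with \<open>\<bar>\<theta>\<bar> > 4 \<bar>y\<bar>\<close> has likelihood at most \<open>\<phi>(y) exp (-\<theta>\<^sup>2/4)\<close>, and \<open>\<phi>(y)\<close> is dominated by the marginal.\<close>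

lemma post_moment_growth:
  assumes k: "1 \<le> k" "k \<le> 2" and y: "1 \<le> \<bar>y\<bar>"
  shows "post_mean q (\<lambda>\<theta>. ennreal (\<bar>\<theta>\<bar> ^ k)) y \<le> ennreal ((16 + 4 / c_origin) * y\<^sup>2)"
proof (rule post_mean_leI)
  let ?m = "marginal q y"
  have pw: "\<bar>\<theta>\<bar> ^ k * normal_density \<theta> 1 y \<le> 16 * y\<^sup>2 * normal_density \<theta> 1 y + 4 * y\<^sup>2 * std_normal_density y" for \<theta>
  proof (cases "\<bar>\<theta>\<bar> \<le> 4 * \<bar>y\<bar>")
    case True
    have "\<bar>\<theta>\<bar> ^ k \<le> (4 * \<bar>y\<bar>) ^ k" using True by (intro power_mono) auto
    also have "\<dots> \<le> (4 * \<bar>y\<bar>)\<^sup>2" using k y by (intro power_le_square_of_ge_1) auto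
    also have "\<dots> = 16 * y\<^sup>2" by (simp add: power_mult_distrib)
    finally show ?thesis by (simp add: mult_right_mono add_increasing2)
  next
    case False
    have "3/4 * \<bar>\<theta>\<bar> \<le> \<bar>y - \<theta>\<bar>" using False by linarith
    then have "(3/4 * \<bar>\<theta>\<bar>)\<^sup>2 \<le> (y - \<theta>)\<^sup>2" by (subst power2_abs[of "y - \<theta>", symmetric], intro power_mono) auto
    moreover have "y\<^sup>2 \<le> (\<bar>\<theta>\<bar> / 4)\<^sup>2"
      using False by (subst power2_abs[of y, symmetric], intro power_mono) auto
    ultimately have "- (y - \<theta>)\<^sup>2 / 2 \<le> - y\<^sup>2 / 2 + - (\<theta>\<^sup>2 / 4)"
      by (simp add: power_mult_distrib power_divide)
    then have e: "exp (- (y - \<theta>)\<^sup>2 / 2) \<le> exp (- y\<^sup>2 / 2) * exp (- (\<theta>\<^sup>2 / 4))"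
      unfolding exp_add[symmetric] by (subst exp_le_cancel_iff)
    then have "normal_density \<theta> 1 y \<le> std_normal_density y * exp (- (\<theta>\<^sup>2 / 4))"
      unfolding normal_density_def by (simp add: divide_right_mono)
    moreover have "\<bar>\<theta>\<bar> ^ k \<le> \<theta>\<^sup>2"
      using power_le_square_of_ge_1[OF k, of "\<bar>\<theta>\<bar>"] False y by simp
    ultimately have "\<bar>\<theta>\<bar> ^ k * normal_density \<theta> 1 y \<le> \<theta>\<^sup>2 * (std_normal_density y * exp (- (\<theta>\<^sup>2 / 4)))"
      by (intro mult_mono) auto
    also have "\<dots> = (\<theta>\<^sup>2 * exp (- (\<theta>\<^sup>2 / 4))) * std_normal_density y" by (simp only: mult_ac)
    also have "\<dots> \<le> 4 * std_normal_density y"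
      by (intro mult_right_mono sq_times_exp_le) auto
    also have "\<dots> \<le> (4 * y\<^sup>2) * std_normal_density y"
      using y one_le_power[of "\<bar>y\<bar>" 2] by (intro mult_right_mono) auto
    finally show ?thesis by (simp add: add_increasing)
  qed
  have "(\<integral>\<^sup>+ \<theta>. ennreal (\<bar>\<theta>\<bar> ^ k) * ennreal (normal_density \<theta> 1 y * q \<theta>) \<partial>lborel)
     \<le> (\<integral>\<^sup>+ \<theta>. ennreal (16 * y\<^sup>2) * ennreal (normal_density \<theta> 1 y * q \<theta>) + ennreal (4 * y\<^sup>2 * std_normal_density y) * ennreal (q \<theta>) \<partial>lborel)"
  proof (intro nn_integral_mono)
    fix \<theta>
    have "\<bar>\<theta>\<bar> ^ k * normal_density \<theta> 1 y * q \<theta> \<le> (16 * y\<^sup>2 * normal_density \<theta> 1 y + 4 * y\<^sup>2 * std_normal_density y) * q \<theta>"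
      by (rule mult_right_mono[OF pw q_nonneg])
    then show "ennreal (\<bar>\<theta>\<bar> ^ k) * ennreal (normal_density \<theta> 1 y * q \<theta>)
      \<le> ennreal (16 * y\<^sup>2) * ennreal (normal_density \<theta> 1 y * q \<theta>) + ennreal (4 * y\<^sup>2 * std_normal_density y) * ennreal (q \<theta>)"
      using q_nonneg[of \<theta>]
      by (simp add: ennreal_mult[symmetric] ennreal_plus[symmetric] distrib_right mult.assoc ennreal_leI del: ennreal_plus)
  qed
  also have "\<dots> = ennreal (16 * y\<^sup>2) * ?m + ennreal (4 * y\<^sup>2 * std_normal_density y)"
    unfolding marginal_def by (subst nn_integral_add) (auto simp: nn_integral_cmult q_total)
  also have "ennreal (4 * y\<^sup>2 * std_normal_density y) = ennreal (4 * y\<^sup>2 / c_origin) * ennreal (c_origin * std_normal_density y)"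
    using c_origin_pos by (simp add: ennreal_mult[symmetric])
  also have "ennreal (16 * y\<^sup>2) * ?m + \<dots> \<le> ennreal (16 * y\<^sup>2) * ?m + ennreal (4 * y\<^sup>2 / c_origin) * ?m"
    by (intro add_left_mono mult_left_mono marginal_ge_at_origin) auto
  also have "\<dots> = ennreal ((16 + 4 / c_origin) * y\<^sup>2) * ?m"
  proof -
    have "(16 + 4 / c_origin) * y\<^sup>2 = 16 * y\<^sup>2 + 4 * y\<^sup>2 / c_origin" by (simp add: distrib_right)
    then show ?thesis
      using c_origin_pos by (simp add: ennreal_plus distrib_right)
  qed
  finally show "(\<integral>\<^sup>+ \<theta>. ennreal (\<bar>\<theta>\<bar> ^ k) * ennreal (normal_density \<theta> 1 y * q \<theta>) \<partial>lborel) \<le> ennreal ((16 + 4 / c_origin) * y\<^sup>2) * ?m" .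
qed

text \<open>The bound for a zero coordinate: three levels of the prior moment truncated at \<open>2 T\<close>, and the
  contribution of observations beyond \<open>T\<close>. Two levels \<open>\<delta>1\<close>, \<open>\<delta>2\<close> are needed for the first moment, where a
  single one would lose a logarithmic factor. The argument \<open>b'\<close> is an upper bound for \<open>b\<close>.\<close>

definition null_risk :: "real \<Rightarrow> nat \<Rightarrow> real \<Rightarrow> real \<Rightarrow> real \<Rightarrow> real" where
  "null_risk b' k \<delta>1 \<delta>2 T =
     (\<delta>1 ^ k + \<delta>2 ^ k * (D * b' * \<delta>1 powr (1 - \<alpha>)) + (2 * T) ^ k * (D * b' * \<delta>2 powr (1 - \<alpha>))) / c_origin
     + (16 + 4 / c_origin) * 16 * exp (- T\<^sup>2 / 4)"

text \<open>For \<open>\<bar>y\<bar> \<le> T\<close>, replacing the marginal by \<open>c_origin * \<phi>(y)\<close> cancels the density of \<open>y\<close>. Exchanging the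
  integrals leaves the prior integral of \<open>\<bar>\<theta>\<bar>\<^sup>k\<close> times the probability that \<open>N(\<theta>,1)\<close> hits \<open>[-T,T]\<close>, which
  cuts off \<open>\<bar>\<theta>\<bar> > 2 T\<close>. For \<open>\<bar>y\<bar> > T\<close> the crude growth bound suffices.\<close>

lemma null_coordinate_risk:
  assumes k: "1 \<le> k" "k \<le> 2" and T: "2 \<le> T" and b': "b \<le> b'" and \<delta>: "0 < \<delta>1" "0 < \<delta>2" "\<delta>2 \<le> 2 * T"
  shows "(\<integral>\<^sup>+ y. ennreal (std_normal_density y) * post_mean q (\<lambda>\<theta>. ennreal (\<bar>\<theta>\<bar> ^ k)) y \<partial>lborel)
     \<le> ennreal (null_risk b' k \<delta>1 \<delta>2 T)"
proof -
  let ?N = "\<lambda>y. \<integral>\<^sup>+ \<theta>. ennreal (\<bar>\<theta>\<bar> ^ k) * ennreal (normal_density \<theta> 1 y * q \<theta>) \<partial>lborel"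
  let ?pm = "\<lambda>y. post_mean q (\<lambda>\<theta>. ennreal (\<bar>\<theta>\<bar> ^ k)) y"
  have b'0: "0 < b'" using b' b_pos by simp
  have tail: "(\<integral>\<^sup>+ \<theta>. ennreal (q \<theta>) * indicator {\<theta>. \<delta> < \<bar>\<theta>\<bar>} \<theta> \<partial>lborel)
      \<le> ennreal (D * b' * \<delta> powr (1 - \<alpha>))" if "0 < \<delta>" for \<delta>
    by (rule order_trans[OF tail_mass[OF that]]) (use b' D_nonneg in \<open>auto intro!: ennreal_leI mult_right_mono mult_left_mono\<close>)
  define A where "A = 16 + 4 / c_origin"
  have A: "0 < A" using c_origin_pos by (simp add: A_def add_pos_pos)
  have pw: "ennreal (std_normal_density y) * ?pm y
     \<le> ennreal (1 / c_origin) * (?N y * indicator {-T..T} y) + ennreal (A * 16 * exp (- T\<^sup>2 / 4)) * ennreal (normal_density 0 2 y)" for y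
  proof (cases "y \<in> {-T..T}")
    case True
    have "ennreal (std_normal_density y) = ennreal (1 / c_origin) * ennreal (c_origin * std_normal_density y)"
      using c_origin_pos by (simp add: ennreal_mult[symmetric])
    also have "\<dots> \<le> ennreal (1 / c_origin) * marginal q y"
      by (intro mult_left_mono marginal_ge_at_origin) auto
    finally have "ennreal (std_normal_density y) * ?pm y \<le> ennreal (1 / c_origin) * marginal q y * ?pm y"
      by (rule mult_right_mono) simp
    also have "\<dots> = ennreal (1 / c_origin) * ?N y"
      using marginal_pos[of y] marginal_finite[of y] unfolding post_mean_def mult.assoc
      by (subst (2) mult.commute) (simp add: ennreal_divide_times)
    finally show ?thesis using True by (simp add: add_increasing2)
  next
    case False
    then have y: "T \<le> \<bar>y\<bar>" by auto
    have "ennreal (std_normal_density y) * ?pm y \<le> ennreal (std_normal_density y) * ennreal (A * y\<^sup>2)"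
      using post_moment_growth[OF k, of y] y T by (intro mult_left_mono) (auto simp: A_def)
    also have "\<dots> = ennreal (A * (y\<^sup>2 * std_normal_density y))"
      using A by (simp add: ennreal_mult[symmetric] mult_ac)
    also have "\<dots> \<le> ennreal (A * (16 * exp (- T\<^sup>2 / 4) * normal_density 0 2 y))"
      using A y T by (intro ennreal_leI mult_left_mono sq_times_std_normal_density_le) auto
    also have "\<dots> = ennreal (A * 16 * exp (- T\<^sup>2 / 4)) * ennreal (normal_density 0 2 y)"
      using A by (simp add: ennreal_mult[symmetric] mult_ac)
    finally show ?thesis by (simp add: add_increasing)
  qed
  have [measurable]: "?N \<in> borel_measurable borel"
    by measurable
  have Nint: "(\<integral>\<^sup>+ y. ?N y * indicator {-T..T} y \<partial>lborel)
      \<le> ennreal (\<delta>1 ^ k + \<delta>2 ^ k * (D * b' * \<delta>1 powr (1 - \<alpha>)) + (2 * T) ^ k * (D * b' * \<delta>2 powr (1 - \<alpha>)))"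
  proof -
    let ?W = "\<lambda>\<theta>. \<integral>\<^sup>+ y. ennreal (normal_density \<theta> 1 y) * indicator {-T..T} y \<partial>lborel"
    have "(\<integral>\<^sup>+ y. ?N y * indicator {-T..T} y \<partial>lborel)
       = (\<integral>\<^sup>+ y. (\<integral>\<^sup>+ \<theta>. ennreal (\<bar>\<theta>\<bar> ^ k) * ennreal (normal_density \<theta> 1 y * q \<theta>) * indicator {-T..T} y \<partial>lborel) \<partial>lborel)"
      by (subst nn_integral_multc) auto
    also have "\<dots> = (\<integral>\<^sup>+ \<theta>. (\<integral>\<^sup>+ y. ennreal (\<bar>\<theta>\<bar> ^ k) * ennreal (normal_density \<theta> 1 y * q \<theta>) * indicator {-T..T} y \<partial>lborel) \<partial>lborel)"
      by (rule lborel_pair.Fubini') measurable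
    also have "\<dots> = (\<integral>\<^sup>+ \<theta>. ennreal (q \<theta>) * (ennreal (\<bar>\<theta>\<bar> ^ k) * ?W \<theta>) \<partial>lborel)"
      using q_nonneg
      by (intro nn_integral_cong) (simp add: ennreal_mult nn_integral_cmult[symmetric] mult_ac)
    also have "\<dots> \<le> (\<integral>\<^sup>+ \<theta>. ennreal (\<delta>1 ^ k) * ennreal (q \<theta>)
        + (ennreal (\<delta>2 ^ k) * (ennreal (q \<theta>) * indicator {\<theta>. \<delta>1 < \<bar>\<theta>\<bar>} \<theta>)
        + ennreal ((2 * T) ^ k) * (ennreal (q \<theta>) * indicator {\<theta>. \<delta>2 < \<bar>\<theta>\<bar>} \<theta>)) \<partial>lborel)"
    proof (intro nn_integral_mono)
      fix \<theta> :: real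
      have W1: "?W \<theta> \<le> 1"
      proof -
        have "?W \<theta> \<le> (\<integral>\<^sup>+ y. ennreal (normal_density \<theta> 1 y) \<partial>lborel)"
          by (intro nn_integral_mono) (auto simp: indicator_def)
        then show ?thesis by (simp add: nn_integral_normal_density)
      qed
      have small: "ennreal (\<bar>\<theta>\<bar> ^ k) * ?W \<theta> \<le> ennreal (c ^ k)" if "\<bar>\<theta>\<bar> \<le> c" for c
      proof -
        have "ennreal (\<bar>\<theta>\<bar> ^ k) * ?W \<theta> \<le> ennreal (c ^ k) * 1"
          using that W1 by (intro mult_mono ennreal_leI power_mono) auto
        then show ?thesis by simp
      qed
      have large: "ennreal (\<bar>\<theta>\<bar> ^ k) * ?W \<theta> \<le> ennreal ((2 * T) ^ k)" if "2 * T < \<bar>\<theta>\<bar>"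
      proof -
        have "\<bar>\<theta>\<bar> ^ k \<le> \<theta>\<^sup>2"
          using power_le_square_of_ge_1[OF k, of "\<bar>\<theta>\<bar>"] that T by simp
        then have "ennreal (\<bar>\<theta>\<bar> ^ k) * ?W \<theta> \<le> ennreal (\<theta>\<^sup>2) * ennreal (4 / \<theta>\<^sup>2)"
          using normal_window_prob_le[OF that] T by (intro mult_mono ennreal_leI) auto
        also have "\<dots> = ennreal 4" using that T by (subst ennreal_mult[symmetric]) auto
        also have "\<dots> \<le> ennreal ((2 * T) ^ k)"
          using self_le_power[of "2 * T" k] T k by (intro ennreal_leI) auto
        finally show ?thesis .
      qed
      have "ennreal (\<bar>\<theta>\<bar> ^ k) * ?W \<theta> \<le> ennreal (\<delta>1 ^ k)
        + (ennreal (\<delta>2 ^ k) * indicator {\<theta>. \<delta>1 < \<bar>\<theta>\<bar>} \<theta> + ennreal ((2 * T) ^ k) * indicator {\<theta>. \<delta>2 < \<bar>\<theta>\<bar>} \<theta>)"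
        (is "?lhs \<le> _")
      proof -
        consider "\<bar>\<theta>\<bar> \<le> \<delta>1" | "\<delta>1 < \<bar>\<theta>\<bar>" "\<bar>\<theta>\<bar> \<le> \<delta>2" | "\<delta>2 < \<bar>\<theta>\<bar>" by linarith
        then show ?thesis
        proof cases
          case 1
          then show ?thesis using small[of \<delta>1] by (simp add: add_increasing2)
        next
          case 2
          then have "?lhs \<le> ennreal (\<delta>2 ^ k)" using small[of \<delta>2] by simp
          then show ?thesis using 2 by (simp add: add_increasing add_increasing2)
        next
          case 3
          then have "?lhs \<le> ennreal ((2 * T) ^ k)" using small[of "2 * T"] large by fastforce
          then show ?thesis using 3 by (simp add: add_increasing)
        qed
      qed
      then have "ennreal (q \<theta>) * (ennreal (\<bar>\<theta>\<bar> ^ k) * ?W \<theta>) \<le> ennreal (q \<theta>) * (ennreal (\<delta>1 ^ k)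
        + (ennreal (\<delta>2 ^ k) * indicator {\<theta>. \<delta>1 < \<bar>\<theta>\<bar>} \<theta> + ennreal ((2 * T) ^ k) * indicator {\<theta>. \<delta>2 < \<bar>\<theta>\<bar>} \<theta>))"
        by (rule mult_left_mono) simp
      then show "ennreal (q \<theta>) * (ennreal (\<bar>\<theta>\<bar> ^ k) * ?W \<theta>) \<le> ennreal (\<delta>1 ^ k) * ennreal (q \<theta>)
        + (ennreal (\<delta>2 ^ k) * (ennreal (q \<theta>) * indicator {\<theta>. \<delta>1 < \<bar>\<theta>\<bar>} \<theta>)
        + ennreal ((2 * T) ^ k) * (ennreal (q \<theta>) * indicator {\<theta>. \<delta>2 < \<bar>\<theta>\<bar>} \<theta>))"
        by (simp only: distrib_left mult_ac)
    qed
    also have "\<dots> = ennreal (\<delta>1 ^ k)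
        + (ennreal (\<delta>2 ^ k) * (\<integral>\<^sup>+ \<theta>. ennreal (q \<theta>) * indicator {\<theta>. \<delta>1 < \<bar>\<theta>\<bar>} \<theta> \<partial>lborel)
        + ennreal ((2 * T) ^ k) * (\<integral>\<^sup>+ \<theta>. ennreal (q \<theta>) * indicator {\<theta>. \<delta>2 < \<bar>\<theta>\<bar>} \<theta> \<partial>lborel))"
      by (simp add: nn_integral_add nn_integral_cmult q_total)
    also have "\<dots> \<le> ennreal (\<delta>1 ^ k) + (ennreal (\<delta>2 ^ k) * ennreal (D * b' * \<delta>1 powr (1 - \<alpha>))
        + ennreal ((2 * T) ^ k) * ennreal (D * b' * \<delta>2 powr (1 - \<alpha>)))"
      using \<delta> by (intro add_left_mono add_mono mult_left_mono tail) auto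
    also have "\<dots> = ennreal (\<delta>1 ^ k + \<delta>2 ^ k * (D * b' * \<delta>1 powr (1 - \<alpha>)) + (2 * T) ^ k * (D * b' * \<delta>2 powr (1 - \<alpha>)))"
      using \<delta> T D_nonneg b'0 by (simp add: ennreal_mult[symmetric] ennreal_plus[symmetric] add.assoc del: ennreal_plus)
    finally show ?thesis .
  qed
  have "(\<integral>\<^sup>+ y. ennreal (std_normal_density y) * ?pm y \<partial>lborel)
    \<le> (\<integral>\<^sup>+ y. ennreal (1 / c_origin) * (?N y * indicator {-T..T} y) + ennreal (A * 16 * exp (- T\<^sup>2 / 4)) * ennreal (normal_density 0 2 y) \<partial>lborel)"
    by (intro nn_integral_mono pw)
  also have "\<dots> = ennreal (1 / c_origin) * (\<integral>\<^sup>+ y. ?N y * indicator {-T..T} y \<partial>lborel) + ennreal (A * 16 * exp (- T\<^sup>2 / 4))"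
    by (subst nn_integral_add) (auto simp: nn_integral_cmult nn_integral_normal_density)
  also have "\<dots> \<le> ennreal (1 / c_origin) * ennreal (\<delta>1 ^ k + \<delta>2 ^ k * (D * b' * \<delta>1 powr (1 - \<alpha>)) + (2 * T) ^ k * (D * b' * \<delta>2 powr (1 - \<alpha>)))
      + ennreal (A * 16 * exp (- T\<^sup>2 / 4))"
    by (intro add_right_mono mult_left_mono Nint) auto
  also have "\<dots> = ennreal (null_risk b' k \<delta>1 \<delta>2 T)"
    using \<delta> T D_nonneg b'0 c_origin_pos A unfolding null_risk_def A_def[symmetric]
    by (simp add: ennreal_mult[symmetric] ennreal_plus[symmetric] del: ennreal_plus)
  finally show ?thesis .
qed

end

section \<open>From coordinates to the distance between vectors\<close>

text \<open>What remains of the error at one coordinate after the threshold \<open>t\<close> is subtracted at the coordinates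
  with a nonzero true value.\<close>

definition coordinate_dev :: "real \<Rightarrow> real \<Rightarrow> real \<Rightarrow> real \<Rightarrow> real" where
  "coordinate_dev \<theta>0 t y \<theta> =
     (if \<theta>0 = 0 then \<bar>\<theta>\<bar> else \<bar>y - \<theta>0\<bar> + max 0 (\<bar>\<theta> - y\<bar> - t))"

lemma coordinate_dev_nonneg: "0 \<le> coordinate_dev \<theta>0 t y \<theta>"
  by (simp add: coordinate_dev_def)

lemma error_le_coordinate_dev:
  "\<bar>\<theta> - \<theta>0\<bar> \<le> (if \<theta>0 = 0 then 0 else t) + coordinate_dev \<theta>0 t y \<theta>"
  by (auto simp: coordinate_dev_def)

lemma l1_dist_le_coordinate_dev:
  "l1_dist n \<theta> \<theta>0 \<le> real (nonzero_count n \<theta>0) * t + (\<Sum>i<n. coordinate_dev (\<theta>0 i) t (y i) (\<theta> i))"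
proof -
  have "l1_dist n \<theta> \<theta>0 \<le> (\<Sum>i<n. (if \<theta>0 i = 0 then 0 else t) + coordinate_dev (\<theta>0 i) t (y i) (\<theta> i))"
    unfolding l1_dist_def by (intro sum_mono error_le_coordinate_dev)
  also have "\<dots> = (\<Sum>i\<in>{i. i < n \<and> \<theta>0 i \<noteq> 0}. t) + (\<Sum>i<n. coordinate_dev (\<theta>0 i) t (y i) (\<theta> i))"
    unfolding sum.distrib
    by (intro arg_cong2[where f="(+)"] refl sum.mono_neutral_cong_right) auto
  finally show ?thesis by (simp add: nonzero_count_def)
qed

lemma l2_dist_le_coordinate_dev:
  assumes "0 \<le> t"
  shows "l2_dist n \<theta> \<theta>0 \<le> sqrt (real (nonzero_count n \<theta>0)) * t
     + sqrt (\<Sum>i<n. (coordinate_dev (\<theta>0 i) t (y i) (\<theta> i))\<^sup>2)"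
proof -
  let ?t = "\<lambda>i. if \<theta>0 i = 0 then 0 else t"
  let ?d = "\<lambda>i. coordinate_dev (\<theta>0 i) t (y i) (\<theta> i)"
  have "l2_dist n \<theta> \<theta>0 = L2_set (\<lambda>i. \<bar>\<theta> i - \<theta>0 i\<bar>) {..<n}"
    by (simp add: l2_dist_def L2_set_def)
  also have "\<dots> \<le> L2_set (\<lambda>i. ?t i + ?d i) {..<n}"
    by (intro L2_set_mono error_le_coordinate_dev) auto
  also have "\<dots> \<le> L2_set ?t {..<n} + L2_set ?d {..<n}"
    by (rule L2_set_triangle_ineq)
  also have "L2_set ?t {..<n} = sqrt (real (nonzero_count n \<theta>0)) * t"
  proof -
    have "(\<Sum>i<n. (?t i)\<^sup>2) = (\<Sum>i\<in>{i. i < n \<and> \<theta>0 i \<noteq> 0}. t\<^sup>2)"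
      by (intro sum.mono_neutral_cong_right) auto
    then show ?thesis
      using assms by (simp add: L2_set_def nonzero_count_def real_sqrt_mult)
  qed
  finally show ?thesis by (simp add: L2_set_def)
qed

lemma power_sum_le:
  fixes u v :: real and k :: nat
  assumes "1 \<le> k" "k \<le> 2" "0 \<le> u" "0 \<le> v"
  shows "(u + v) ^ k \<le> 2 * (u ^ k + v ^ k)"
proof -
  consider "k = 1" | "k = 2" using assms by linarith
  then show ?thesis
  proof cases
    case 2
    have "0 \<le> (u - v)\<^sup>2" by simp
    then show ?thesis using 2 by (simp add: power2_eq_square algebra_simps)
  qed (use assms in simp)
qed

lemma power_le_one_plus_square: "1 \<le> k \<Longrightarrow> k \<le> 2 \<Longrightarrow> 0 \<le> u \<Longrightarrow> u ^ k \<le> 1 + u\<^sup>2"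
  for u :: real and k :: nat
  by (cases "u \<le> 1") (auto intro: order_trans[OF power_le_one] order_trans[OF power_le_square_of_ge_1])

context heavy_tailed_prior
begin

lemma null_risk_nonneg: "0 \<le> b' \<Longrightarrow> 0 \<le> \<delta>1 \<Longrightarrow> 0 \<le> \<delta>2 \<Longrightarrow> 0 \<le> T \<Longrightarrow> 0 \<le> null_risk b' k \<delta>1 \<delta>2 T"
  unfolding null_risk_def using c_origin_pos D_nonneg
  by (intro add_nonneg_nonneg divide_nonneg_pos mult_nonneg_nonneg) auto

lemma post_mean_affine_le:
  assumes [measurable]: "g \<in> borel_measurable borel" and le: "\<And>\<theta>. h \<theta> \<le> a + c * g \<theta>"
  shows "post_mean q h y \<le> a + c * post_mean q g y"
proof (rule post_mean_leI)
  let ?w = "\<lambda>\<theta>. ennreal (normal_density \<theta> 1 y * q \<theta>)"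
  have "(\<integral>\<^sup>+ \<theta>. h \<theta> * ?w \<theta> \<partial>lborel) \<le> (\<integral>\<^sup>+ \<theta>. a * ?w \<theta> + c * (g \<theta> * ?w \<theta>) \<partial>lborel)"
  proof (intro nn_integral_mono)
    fix \<theta>
    have "h \<theta> * ?w \<theta> \<le> (a + c * g \<theta>) * ?w \<theta>" by (intro mult_right_mono le) simp
    then show "h \<theta> * ?w \<theta> \<le> a * ?w \<theta> + c * (g \<theta> * ?w \<theta>)" by (simp add: distrib_right mult.assoc)
  qed
  also have "\<dots> = a * marginal q y + c * (\<integral>\<^sup>+ \<theta>. g \<theta> * ?w \<theta> \<partial>lborel)"
    unfolding marginal_def by (subst nn_integral_add) (auto simp: nn_integral_cmult)
  also have "(\<integral>\<^sup>+ \<theta>. g \<theta> * ?w \<theta> \<partial>lborel) = post_mean q g y * marginal q y"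
    using marginal_pos[of y] marginal_finite[of y] unfolding post_mean_def
    by (simp add: ennreal_divide_times)
  finally show "(\<integral>\<^sup>+ \<theta>. h \<theta> * ?w \<theta> \<partial>lborel) \<le> (a + c * post_mean q g y) * marginal q y"
    by (simp add: distrib_right mult.assoc)
qed

text \<open>The noise \<open>x\<close> has second moment \<open>1\<close>, the excess over \<open>t\<close> has second posterior moment at most
  \<open>excess_const B\<close>, and \<open>u\<^sup>k \<le> 1 + u\<^sup>2\<close> handles both exponents at once.\<close>

lemma signal_coordinate_risk:
  assumes k: "1 \<le> k" "k \<le> 2" and t: "0 \<le> t" and b_ge: "exp (- \<kappa> * t\<^sup>2) \<le> b" and \<kappa>: "0 \<le> \<kappa>"
    and B: "\<And>u. 0 \<le> u \<Longrightarrow> u\<^sup>2 * (2 * u) powr \<alpha> * exp (- (1/2 - \<kappa>) * u\<^sup>2) \<le> B"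
    and \<theta>0: "\<theta>0 \<noteq> 0"
  shows "(\<integral>\<^sup>+ x. ennreal (std_normal_density x) *
      post_mean q (\<lambda>\<theta>. ennreal (coordinate_dev \<theta>0 t (\<theta>0 + x) \<theta> ^ k)) (\<theta>0 + x) \<partial>lborel)
    \<le> ennreal (2 * (3 + excess_const B))"
proof -
  let ?C = "excess_const B"
  have "0 \<le> B" using B[of 0] by simp
  then have C0: "0 \<le> ?C" by (rule excess_const_nonneg)
  have pm: "post_mean q (\<lambda>\<theta>. ennreal (coordinate_dev \<theta>0 t (\<theta>0 + x) \<theta> ^ k)) (\<theta>0 + x)
      \<le> ennreal (2 * (2 + x\<^sup>2 + ?C))" for x
  proof -
    let ?w = "\<lambda>\<theta>. max 0 (\<bar>\<theta> - (\<theta>0 + x)\<bar> - t)"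
    have "post_mean q (\<lambda>\<theta>. ennreal (coordinate_dev \<theta>0 t (\<theta>0 + x) \<theta> ^ k)) (\<theta>0 + x)
      \<le> ennreal (2 * (2 + x\<^sup>2)) + ennreal 2 * post_mean q (\<lambda>\<theta>. ennreal ((?w \<theta>)\<^sup>2)) (\<theta>0 + x)"
    proof (rule post_mean_affine_le)
      fix \<theta>
      have "coordinate_dev \<theta>0 t (\<theta>0 + x) \<theta> ^ k = (\<bar>x\<bar> + ?w \<theta>) ^ k"
        using \<theta>0 by (simp add: coordinate_dev_def)
      also have "\<dots> \<le> 2 * (\<bar>x\<bar> ^ k + ?w \<theta> ^ k)" by (rule power_sum_le[OF k]) auto
      also have "\<dots> \<le> 2 * ((1 + \<bar>x\<bar>\<^sup>2) + (1 + (?w \<theta>)\<^sup>2))"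
        by (intro mult_left_mono add_mono power_le_one_plus_square k) auto
      also have "\<dots> = 2 * (2 + x\<^sup>2) + 2 * (?w \<theta>)\<^sup>2" by simp
      finally have "ennreal (coordinate_dev \<theta>0 t (\<theta>0 + x) \<theta> ^ k) \<le> ennreal (2 * (2 + x\<^sup>2) + 2 * (?w \<theta>)\<^sup>2)"
        by (rule ennreal_leI)
      also have "\<dots> = ennreal (2 * (2 + x\<^sup>2)) + ennreal 2 * ennreal ((?w \<theta>)\<^sup>2)"
        by (subst ennreal_plus) (auto simp: ennreal_mult)
      finally show "ennreal (coordinate_dev \<theta>0 t (\<theta>0 + x) \<theta> ^ k)
         \<le> ennreal (2 * (2 + x\<^sup>2)) + ennreal 2 * ennreal ((?w \<theta>)\<^sup>2)" .
    qed simp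
    also have "\<dots> \<le> ennreal (2 * (2 + x\<^sup>2)) + ennreal 2 * ennreal ?C"
      using post_mean_excess_bound[OF t b_ge \<kappa> B, of "\<theta>0 + x"]
      by (intro add_left_mono mult_left_mono) auto
    also have "\<dots> = ennreal (2 * (2 + x\<^sup>2) + 2 * ?C)"
      using C0 by (subst ennreal_plus) (auto simp: ennreal_mult)
    also have "2 * (2 + x\<^sup>2) + 2 * ?C = 2 * (2 + x\<^sup>2 + ?C)" by simp
    finally show ?thesis .
  qed
  have "(\<integral>\<^sup>+ x. ennreal (std_normal_density x) *
      post_mean q (\<lambda>\<theta>. ennreal (coordinate_dev \<theta>0 t (\<theta>0 + x) \<theta> ^ k)) (\<theta>0 + x) \<partial>lborel)
    \<le> (\<integral>\<^sup>+ x. ennreal (2 * (2 + ?C)) * ennreal (std_normal_density x) + ennreal 2 * ennreal ((x - 0)\<^sup>2 * std_normal_density x) \<partial>lborel)"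
  proof (intro nn_integral_mono)
    fix x
    have "ennreal (std_normal_density x) * post_mean q (\<lambda>\<theta>. ennreal (coordinate_dev \<theta>0 t (\<theta>0 + x) \<theta> ^ k)) (\<theta>0 + x)
      \<le> ennreal (std_normal_density x) * ennreal (2 * (2 + x\<^sup>2 + ?C))"
      by (intro mult_left_mono pm) simp
    also have "\<dots> = ennreal (2 * (2 + ?C) * std_normal_density x + 2 * ((x - 0)\<^sup>2 * std_normal_density x))"
      using C0 by (subst ennreal_mult[symmetric]) (auto simp: algebra_simps)
    also have "\<dots> = ennreal (2 * (2 + ?C)) * ennreal (std_normal_density x) + ennreal 2 * ennreal ((x - 0)\<^sup>2 * std_normal_density x)"
      using C0 by (subst ennreal_plus) (auto simp: ennreal_mult)
    finally show "ennreal (std_normal_density x) * post_mean q (\<lambda>\<theta>. ennreal (coordinate_dev \<theta>0 t (\<theta>0 + x) \<theta> ^ k)) (\<theta>0 + x) \<le> \<dots>" .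
  qed
  also have "\<dots> = ennreal (2 * (2 + ?C)) + ennreal 2"
    using nn_integral_normal_density[of 1 0] nn_integral_normal_second_moment[of 0]
    by (subst nn_integral_add, simp, simp, subst nn_integral_cmult, simp, subst nn_integral_cmult, simp, simp only: zero_less_one simp_thms mult_1_right)
  also have "\<dots> = ennreal (2 * (2 + ?C) + 2)" using C0 by (subst ennreal_plus) auto
  also have "2 * (2 + ?C) + 2 = 2 * (3 + ?C)" by simp
  finally show ?thesis .
qed

text \<open>A non-asymptotic bound: at most a constant for each nonzero coordinate and \<open>null_risk\<close> for each
  coordinate, relative to the total loss \<open>\<rho>\<close> that the event forces.\<close>

lemma posterior_deviation_le:
  assumes f [measurable]: "f \<in> borel_measurable borel" and f0: "\<And>x. 0 \<le> f x" and \<tau>: "0 < \<tau>"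
    and q: "q = scaled_density f \<tau>"
    and k: "1 \<le> k" "k \<le> 2" and t: "0 \<le> t" and b_ge: "exp (- \<kappa> * t\<^sup>2) \<le> b" and \<kappa>: "0 \<le> \<kappa>"
    and B: "\<And>u. 0 \<le> u \<Longrightarrow> u\<^sup>2 * (2 * u) powr \<alpha> * exp (- (1/2 - \<kappa>) * u\<^sup>2) \<le> B"
    and T: "2 \<le> T" and b': "b \<le> b'" and \<delta>: "0 < \<delta>1" "0 < \<delta>2" "\<delta>2 \<le> 2 * T"
    and \<rho>: "0 < \<rho>"
    and P: "\<And>\<theta> y. P \<theta> \<Longrightarrow> \<rho> \<le> (\<Sum>i<n. coordinate_dev (\<theta>0 i) t (y i) (\<theta> i) ^ k)"
  shows "expected_posterior n f \<tau> \<theta>0 P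
    \<le> (real (nonzero_count n \<theta>0) * (2 * (3 + excess_const B)) + real n * null_risk b' k \<delta>1 \<delta>2 T) / \<rho>"
proof -
  let ?R = "null_risk b' k \<delta>1 \<delta>2 T"
  have R0: "0 \<le> ?R" using b' b_pos \<delta> T by (intro null_risk_nonneg) auto
  have "0 \<le> B" using B[of 0] by simp
  then have C0: "0 \<le> excess_const B" by (rule excess_const_nonneg)
  let ?\<beta> = "\<lambda>i. if \<theta>0 i = 0 then ?R else 2 * (3 + excess_const B)"
  have "expected_posterior n f \<tau> \<theta>0 P \<le> (\<Sum>i<n. ?\<beta> i) / \<rho>"
  proof (rule expected_posterior_le[OF f f0 \<tau>])
    show "marginal (scaled_density f \<tau>) y \<noteq> 0" "marginal (scaled_density f \<tau>) y \<noteq> \<infinity>" for y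
      using marginal_pos[of y] marginal_finite[of y] unfolding q by auto
    show "(\<lambda>(y, \<theta>). ennreal (coordinate_dev (\<theta>0 i) t y \<theta> ^ k)) \<in> borel_measurable (borel \<Otimes>\<^sub>M borel)" for i
      unfolding coordinate_dev_def by measurable
    show "ennreal \<rho> \<le> (\<Sum>i<n. ennreal (coordinate_dev (\<theta>0 i) t (y i) (\<theta> i) ^ k))" if "P \<theta>" for \<theta> y
      using P[OF that, of y] by (simp add: sum_ennreal coordinate_dev_nonneg ennreal_leI)
    show "0 \<le> ?\<beta> i" for i using R0 C0 by simp
    show "(\<integral>\<^sup>+ x. ennreal (std_normal_density x) * post_mean (scaled_density f \<tau>)
       (\<lambda>\<theta>. ennreal (coordinate_dev (\<theta>0 i) t (\<theta>0 i + x) \<theta> ^ k)) (\<theta>0 i + x) \<partial>lborel) \<le> ennreal (?\<beta> i)" for i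
    proof (cases "\<theta>0 i = 0")
      case True
      then show ?thesis
        using null_coordinate_risk[OF k T b' \<delta>] by (simp add: coordinate_dev_def q)
    next
      case False
      then show ?thesis
        using signal_coordinate_risk[OF k t b_ge \<kappa> B False] by (simp add: q)
    qed
  qed (rule \<rho>)
  also have "(\<Sum>i<n. ?\<beta> i) \<le> (\<Sum>i<n. (if \<theta>0 i = 0 then 0 else 2 * (3 + excess_const B)) + ?R)"
    using R0 C0 by (intro sum_mono) auto
  also have "\<dots> = (\<Sum>i\<in>{i. i < n \<and> \<theta>0 i \<noteq> 0}. 2 * (3 + excess_const B)) + real n * ?R"
    unfolding sum.distrib
    by (intro arg_cong2[where f="(+)"] sum.mono_neutral_cong_right) auto
  also have "\<dots> = real (nonzero_count n \<theta>0) * (2 * (3 + excess_const B)) + real n * ?R"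
    by (simp add: nonzero_count_def)
  finally show ?thesis using \<rho> by (simp add: divide_right_mono)
qed

end

lemma expected_posterior_nonneg: "0 \<le> expected_posterior n f \<tau> \<theta>0 P"
  unfolding expected_posterior_def by (intro integral_nonneg_AE) auto

section \<open>The scaled prior has a spike and polynomial tails\<close>

lemma nn_integral_scaled_density:
  assumes [measurable]: "f \<in> borel_measurable borel" "g \<in> borel_measurable borel"
    and f0: "\<And>x. 0 \<le> f x" and \<tau>: "0 < \<tau>"
  shows "(\<integral>\<^sup>+ \<theta>. ennreal (scaled_density f \<tau> \<theta>) * g \<theta> \<partial>lborel) = (\<integral>\<^sup>+ x. ennreal (f x) * g (\<tau> * x) \<partial>lborel)"
proof -
  have "(\<integral>\<^sup>+ \<theta>. ennreal (scaled_density f \<tau> \<theta>) * g \<theta> \<partial>lborel)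
      = ennreal \<bar>\<tau>\<bar> * (\<integral>\<^sup>+ x. ennreal (scaled_density f \<tau> (0 + \<tau> * x)) * g (0 + \<tau> * x) \<partial>lborel)"
    using \<tau> by (intro nn_integral_real_affine) (auto simp: scaled_density_def)
  also have "\<dots> = (\<integral>\<^sup>+ x. ennreal \<tau> * (ennreal (scaled_density f \<tau> (\<tau> * x)) * g (\<tau> * x)) \<partial>lborel)"
    using \<tau> by (subst nn_integral_cmult) (auto simp: scaled_density_def)
  also have "\<dots> = (\<integral>\<^sup>+ x. ennreal (f x) * g (\<tau> * x) \<partial>lborel)"
    using \<tau> f0 by (intro nn_integral_cong) (simp add: scaled_density_def mult.assoc[symmetric] ennreal_mult[symmetric])
  finally show ?thesis .
qed

lemma nn_integral_powr_tail:
  assumes "1 < \<alpha>" "0 < a"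
  shows "(\<integral>\<^sup>+ x. ennreal (x powr (- \<alpha>)) * indicator {a..} x \<partial>lborel) = ennreal (a powr (1 - \<alpha>) / (\<alpha> - 1))"
proof -
  have "((\<lambda>x. x powr (- \<alpha>)) has_integral - (a powr (- \<alpha> + 1)) / (- \<alpha> + 1)) {a..}"
    using assms by (intro has_integral_powr_to_inf) auto
  moreover have "- (a powr (- \<alpha> + 1)) / (- \<alpha> + 1) = a powr (1 - \<alpha>) / (\<alpha> - 1)"
    using assms by (simp add: field_simps)
  ultimately show ?thesis by (intro nn_integral_has_integral_lebesgue') auto
qed

text \<open>For \<open>a \<ge> M\<close> the tail bound is integrated. For \<open>a < M\<close> the total mass \<open>1\<close> already obeys the bound because
  of the summand \<open>M powr (\<alpha> - 1)\<close>.\<close>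

lemma polynomial_tail_mass:
  assumes f [measurable]: "f \<in> borel_measurable borel" and f0: "\<And>x. 0 \<le> f x"
    and total: "(\<integral>\<^sup>+ x. ennreal (f x) \<partial>lborel) = 1"
    and \<alpha>: "1 < \<alpha>" and M: "0 < M" and K: "0 < K"
    and upper: "\<And>x. M < \<bar>x\<bar> \<Longrightarrow> f x \<le> K * \<bar>x\<bar> powr (- \<alpha>)" and a: "0 < a"
  shows "(\<integral>\<^sup>+ x. ennreal (f x) * indicator {x. a < \<bar>x\<bar>} x \<partial>lborel)
     \<le> ennreal ((M powr (\<alpha> - 1) + 2 * K / (\<alpha> - 1)) * a powr (1 - \<alpha>))"
proof (cases "a < M")
  case True
  have "(\<integral>\<^sup>+ x. ennreal (f x) * indicator {x. a < \<bar>x\<bar>} x \<partial>lborel) \<le> (\<integral>\<^sup>+ x. ennreal (f x) \<partial>lborel)"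
    by (intro nn_integral_mono) (auto simp: indicator_def)
  also have "\<dots> = ennreal (M powr (\<alpha> - 1) * M powr (1 - \<alpha>))"
    using M total by (simp add: powr_add[symmetric])
  also have "\<dots> \<le> ennreal ((M powr (\<alpha> - 1) + 2 * K / (\<alpha> - 1)) * a powr (1 - \<alpha>))"
    using True a \<alpha> K by (intro ennreal_leI mult_mono powr_mono2') auto
  finally show ?thesis .
next
  case False
  let ?g = "\<lambda>x. ennreal (x powr (- \<alpha>)) * indicator {a..} x"
  have refl: "(\<integral>\<^sup>+ x. ?g (- x) \<partial>lborel) = (\<integral>\<^sup>+ x. ?g x \<partial>lborel)"
    using nn_integral_real_affine[of ?g "-1" 0] by simp
  have "(\<integral>\<^sup>+ x. ennreal (f x) * indicator {x. a < \<bar>x\<bar>} x \<partial>lborel)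
      \<le> (\<integral>\<^sup>+ x. ennreal K * (?g x + ?g (- x)) \<partial>lborel)"
  proof (intro nn_integral_mono)
    fix x
    show "ennreal (f x) * indicator {x. a < \<bar>x\<bar>} x \<le> ennreal K * (?g x + ?g (- x))"
    proof (cases "a < \<bar>x\<bar>")
      case True
      then have "ennreal (f x) \<le> ennreal (K * \<bar>x\<bar> powr (- \<alpha>))"
        using False by (intro ennreal_leI upper) auto
      also have "\<dots> \<le> ennreal K * (?g x + ?g (- x))"
        using True K a by (cases "0 \<le> x") (auto simp: ennreal_mult indicator_def)
      finally show ?thesis using True by simp
    qed simp
  qed
  also have "\<dots> = ennreal K * (ennreal (a powr (1 - \<alpha>) / (\<alpha> - 1)) + ennreal (a powr (1 - \<alpha>) / (\<alpha> - 1)))"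
    by (simp add: nn_integral_cmult nn_integral_add refl nn_integral_powr_tail[OF \<alpha> a] del: ennreal_plus)
  also have "\<dots> = ennreal (2 * K / (\<alpha> - 1) * a powr (1 - \<alpha>))"
    using K \<alpha> by (simp add: ennreal_plus[symmetric] ennreal_mult[symmetric] del: ennreal_plus)
  also have "\<dots> \<le> ennreal ((M powr (\<alpha> - 1) + 2 * K / (\<alpha> - 1)) * a powr (1 - \<alpha>))"
    by (intro ennreal_leI mult_right_mono) auto
  finally show ?thesis .
qed

text \<open>Unimodality bounds the unscaled density below on \<open>(-1,0)\<close> and \<open>(0,1)\<close>, and scaling by \<open>\<tau> < 1\<close>
  only moves this mass closer to \<open>0\<close>. The bound \<open>\<tau> < 1/(2 M)\<close> sends \<open>\<bar>\<theta>\<bar> \<ge> 1/2\<close> into the range \<open>\<bar>\<theta>/\<tau>\<bar> > M\<close>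
  of the tail condition.\<close>

lemma scaled_prior_heavy_tailed:
  assumes pd: "probability_density f" and um: "unimodal_at_zero f" and pt: "polynomial_tail \<alpha> f"
    and \<alpha>: "1 < \<alpha>"
  obtains p0 D K1 K2 \<tau>0 where "0 < \<tau>0"
    "\<And>\<tau>. 0 < \<tau> \<Longrightarrow> \<tau> < \<tau>0 \<Longrightarrow> heavy_tailed_prior (scaled_density f \<tau>) \<alpha> (\<tau> powr (\<alpha> - 1)) p0 D K1 K2"
proof -
  have f [measurable]: "f \<in> borel_measurable borel" and f0: "0 \<le> f x"
    and total: "(\<integral>\<^sup>+ x. ennreal (f x) \<partial>lborel) = 1" for x
    using pd by (auto simp: probability_density_def)
  obtain M K1 K2 where K: "0 < M" "0 < K1" "K1 < K2"
    and tails: "\<And>x. M < \<bar>x\<bar> \<Longrightarrow> K1 * \<bar>x\<bar> powr (- \<alpha>) \<le> f x \<and> f x \<le> K2 * \<bar>x\<bar> powr (- \<alpha>)"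
    using pt unfolding polynomial_tail_def by blast
  have dec: "f y < f x" if "0 < x" "x < y" for x y
    using um that unfolding unimodal_at_zero_def monotone_on_def by auto
  have inc: "f x \<le> f y" if "x \<le> y" "y < 0" for x y
    using um that unfolding unimodal_at_zero_def monotone_on_def by auto
  define p0 where "p0 = min (f 1) (f (- M - 1))"
  define D where "D = M powr (\<alpha> - 1) + 2 * K2 / (\<alpha> - 1)"
  have "0 < f 1" using dec[of 1 2] f0[of 2] by auto
  moreover have "0 < f (- M - 1)"
  proof -
    have "0 < K1 * \<bar>- M - 1\<bar> powr (- \<alpha>)" using K by auto
    also have "\<dots> \<le> f (- M - 1)" using tails[of "- M - 1"] K by simp
    finally show ?thesis .
  qed
  ultimately have p0: "0 < p0" by (simp add: p0_def)
  show ?thesis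
  proof (rule that)
    show "0 < min 1 (1 / (2 * M))" using K by simp
    fix \<tau> :: real assume \<tau>: "0 < \<tau>" "\<tau> < min 1 (1 / (2 * M))"
    then have \<tau>1: "\<tau> < 1" and \<tau>M: "M < 1 / (2 * \<tau>)" using K by (auto simp: field_simps)
    let ?q = "scaled_density f \<tau>"
    have mass: "ennreal p0 \<le> (\<integral>\<^sup>+ \<theta>. ennreal (?q \<theta>) * indicator A \<theta> \<partial>lborel)"
      if [measurable]: "A \<in> sets borel" "B \<in> sets borel" and "emeasure lborel B = 1"
        and AB: "\<And>x. x \<in> B \<Longrightarrow> p0 \<le> f x \<and> \<tau> * x \<in> A" for A B
    proof -
      have "ennreal p0 = (\<integral>\<^sup>+ x. ennreal p0 * indicator B x \<partial>lborel)"
        using that by (simp add: nn_integral_cmult_indicator)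
      also have "\<dots> \<le> (\<integral>\<^sup>+ x. ennreal (f x) * indicator A (\<tau> * x) \<partial>lborel)"
        using AB by (intro nn_integral_mono) (auto simp: indicator_def intro!: ennreal_leI)
      also have "\<dots> = (\<integral>\<^sup>+ \<theta>. ennreal (?q \<theta>) * indicator A \<theta> \<partial>lborel)"
        using \<tau> f0 by (subst nn_integral_scaled_density) auto
      finally show ?thesis .
    qed
    have far: "M < \<bar>\<theta> / \<tau>\<bar>" if "1/2 \<le> \<bar>\<theta>\<bar>" for \<theta>
    proof -
      have "1 / (2 * \<tau>) \<le> \<bar>\<theta>\<bar> / \<tau>" using that \<tau> by (simp add: field_simps)
      then show ?thesis using \<tau>M \<tau> by simp
    qed
    have scale: "(1 / \<tau>) * (K * \<bar>\<theta> / \<tau>\<bar> powr (- \<alpha>)) = K * \<tau> powr (\<alpha> - 1) * \<bar>\<theta>\<bar> powr (- \<alpha>)" for K \<theta>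
      using \<tau> by (simp add: powr_divide powr_minus powr_diff field_simps)
    show "heavy_tailed_prior ?q \<alpha> (\<tau> powr (\<alpha> - 1)) p0 D K1 K2"
    proof
      show "?q \<in> borel_measurable borel" unfolding scaled_density_def by measurable
      show "0 \<le> ?q \<theta>" for \<theta> using f0 \<tau> by (simp add: scaled_density_def)
      show "(\<integral>\<^sup>+ \<theta>. ennreal (?q \<theta>) \<partial>lborel) = 1"
        using nn_integral_scaled_density[OF f _ f0 \<tau>(1), of "\<lambda>_. 1"] total by simp
      show "ennreal p0 \<le> (\<integral>\<^sup>+ \<theta>. ennreal (?q \<theta>) * indicator {0<..<1} \<theta> \<partial>lborel)"
      proof (rule mass)
        fix x :: real assume x: "x \<in> {0<..<1}"
        then have "\<tau> * x < 1 * 1" using \<tau> \<tau>1 by (intro mult_strict_mono) auto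
        then show "p0 \<le> f x \<and> \<tau> * x \<in> {0<..<1}"
          using x dec[of x 1] \<tau> by (auto simp: p0_def)
      qed auto
      show "ennreal p0 \<le> (\<integral>\<^sup>+ \<theta>. ennreal (?q \<theta>) * indicator {-1<..<0} \<theta> \<partial>lborel)"
      proof (rule mass)
        fix x :: real assume x: "x \<in> {-1<..<0}"
        then have "\<tau> * (- x) < 1 * 1" using \<tau> \<tau>1 by (intro mult_strict_mono) auto
        then show "p0 \<le> f x \<and> \<tau> * x \<in> {-1<..<0}"
          using x inc[of "- M - 1" x] \<tau> K by (auto simp: p0_def mult_pos_neg)
      qed auto
      show "(\<integral>\<^sup>+ \<theta>. ennreal (?q \<theta>) * indicator {\<theta>. \<delta> < \<bar>\<theta>\<bar>} \<theta> \<partial>lborel)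
           \<le> ennreal (D * \<tau> powr (\<alpha> - 1) * \<delta> powr (1 - \<alpha>))" if \<delta>: "0 < \<delta>" for \<delta>
      proof -
        have "(\<integral>\<^sup>+ \<theta>. ennreal (?q \<theta>) * indicator {\<theta>. \<delta> < \<bar>\<theta>\<bar>} \<theta> \<partial>lborel)
           = (\<integral>\<^sup>+ x. ennreal (f x) * indicator {\<theta>. \<delta> < \<bar>\<theta>\<bar>} (\<tau> * x) \<partial>lborel)"
          using \<tau> f0 by (subst nn_integral_scaled_density) auto
        also have "\<dots> = (\<integral>\<^sup>+ x. ennreal (f x) * indicator {x. \<delta> / \<tau> < \<bar>x\<bar>} x \<partial>lborel)"
          using \<tau> by (intro nn_integral_cong) (auto simp: indicator_def abs_mult field_simps)
        also have "\<dots> \<le> ennreal (D * (\<delta> / \<tau>) powr (1 - \<alpha>))"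
          unfolding D_def using K tails \<alpha> f0 total \<delta> \<tau> by (intro polynomial_tail_mass) auto
        also have "(\<delta> / \<tau>) powr (1 - \<alpha>) = \<tau> powr (\<alpha> - 1) * \<delta> powr (1 - \<alpha>)"
          using \<delta> \<tau> by (simp add: powr_divide powr_diff field_simps)
        finally show ?thesis by (simp add: mult.assoc)
      qed
      show "K1 * \<tau> powr (\<alpha> - 1) * \<bar>\<theta>\<bar> powr (- \<alpha>) \<le> ?q \<theta>" if "1/2 \<le> \<bar>\<theta>\<bar>" for \<theta>
        unfolding scaled_density_def scale[symmetric]
        using tails[OF far[OF that]] \<tau> by (intro mult_left_mono) auto
      show "?q \<theta> \<le> K2 * \<tau> powr (\<alpha> - 1) * \<bar>\<theta>\<bar> powr (- \<alpha>)" if "1/2 \<le> \<bar>\<theta>\<bar>" for \<theta>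
        unfolding scaled_density_def scale[symmetric]
        using tails[OF far[OF that]] \<tau> by (intro mult_left_mono) auto
      show "0 \<le> D" using K \<alpha> by (simp add: D_def)
    qed (use p0 K \<tau> \<alpha> in auto)
  qed
qed

section \<open>Rates as the sparsity ratio tends to zero\<close>

lemma small_ln_pos: "\<forall>\<^sub>F x :: real in at_right 0. 0 < x \<and> 0 < ln (1 / x)"
proof -
  have "\<forall>\<^sub>F x :: real in at_right 0. x < 1" "\<forall>\<^sub>F x :: real in at_right 0. 0 < x" by real_asymp+
  then show ?thesis by eventually_elim simp
qed

lemma powr_times_sqrt_powr:
  fixes x :: real
  assumes "0 < x"
  shows "x powr \<alpha> * sqrt x powr (1 - \<alpha>) = x powr ((\<alpha> - 1) / 2) * x"
proof -
  have "x powr \<alpha> * sqrt x powr (1 - \<alpha>) = x powr (\<alpha> + 1/2 * (1 - \<alpha>))"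
    using assms by (simp add: powr_half_sqrt[symmetric] powr_powr powr_add[symmetric])
  also have "\<alpha> + 1/2 * (1 - \<alpha>) = (\<alpha> - 1) / 2 + 1" by (simp add: field_simps)
  finally show ?thesis using assms by (simp add: powr_add)
qed

text \<open>The rates for the \<open>L2\<close> distance, with \<open>x\<close> for \<open>s/n\<close>, the bound \<open>(x L) powr \<alpha>\<close> for \<open>b\<close>, and both
  levels equal to \<open>sqrt x\<close>, where \<open>L = ln (1/x)\<close>.\<close>

lemma l2_rates:
  fixes \<alpha> :: real
  assumes "1 < \<alpha>"
  shows "((\<lambda>x :: real. x / (x * ln (1/x))) \<longlongrightarrow> 0) (at_right 0)" (is ?A)
    and "((\<lambda>x. sqrt x ^ 2 * ((x * ln (1/x)) powr \<alpha> * sqrt x powr (1 - \<alpha>)) / (x * ln (1/x))) \<longlongrightarrow> 0) (at_right 0)" (is ?B)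
    and "((\<lambda>x. (2 * (2 * sqrt (ln (1/x)))) ^ 2 * ((x * ln (1/x)) powr \<alpha> * sqrt x powr (1 - \<alpha>)) / (x * ln (1/x))) \<longlongrightarrow> 0) (at_right 0)" (is ?C)
proof -
  show ?A by real_asymp
  show ?B using assms by real_asymp
  show ?C
  proof (rule Lim_transform_eventually)
    show "((\<lambda>x :: real. 16 * (x powr ((\<alpha> - 1) / 2) * ln (1/x) powr \<alpha>)) \<longlongrightarrow> 0) (at_right 0)"
      using assms by real_asymp
    show "\<forall>\<^sub>F x in at_right 0. 16 * (x powr ((\<alpha> - 1) / 2) * ln (1/x) powr \<alpha>) =
        (2 * (2 * sqrt (ln (1/x)))) ^ 2 * ((x * ln (1/x)) powr \<alpha> * sqrt x powr (1 - \<alpha>)) / (x * ln (1/x))"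
      using small_ln_pos
    proof eventually_elim
      case (elim x)
      have "(x * ln (1/x)) powr \<alpha> * sqrt x powr (1 - \<alpha>) = (x powr \<alpha> * sqrt x powr (1 - \<alpha>)) * ln (1/x) powr \<alpha>"
        using elim by (subst powr_mult) auto
      also have "\<dots> = x powr ((\<alpha> - 1) / 2) * x * ln (1/x) powr \<alpha>"
        using elim by (simp add: powr_times_sqrt_powr)
      finally have *: "(x * ln (1/x)) powr \<alpha> * sqrt x powr (1 - \<alpha>) = x powr ((\<alpha> - 1) / 2) * x * ln (1/x) powr \<alpha>" .
      have sq: "(sqrt (ln (1/x)))\<^sup>2 = ln (1/x)" using elim by (intro real_sqrt_pow2) auto
      show ?case unfolding * power_mult_distrib sq using elim by (simp del: ln_div)
    qed
  qed
qed

text \<open>The rates for the \<open>L1\<close> distance. The lower level \<open>x\<close> is already negligible against \<open>x sqrt L\<close>; the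
  middle one is governed by the tail mass beyond \<open>x\<close>.\<close>

lemma l1_rates:
  fixes \<alpha> :: real
  assumes "1 < \<alpha>"
  shows "((\<lambda>x :: real. x / (x * sqrt (ln (1/x)))) \<longlongrightarrow> 0) (at_right 0)" (is ?A)
    and "((\<lambda>x. sqrt x ^ 1 * (x powr \<alpha> * ln (1/x) powr ((\<alpha> + 1) / 2) * x powr (1 - \<alpha>)) / (x * sqrt (ln (1/x)))) \<longlongrightarrow> 0) (at_right 0)" (is ?B)
    and "((\<lambda>x. (2 * (2 * sqrt (ln (1/x)))) ^ 1 * (x powr \<alpha> * ln (1/x) powr ((\<alpha> + 1) / 2) * sqrt x powr (1 - \<alpha>)) / (x * sqrt (ln (1/x)))) \<longlongrightarrow> 0) (at_right 0)" (is ?C)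
proof -
  show ?A by real_asymp
  show ?B using assms by real_asymp
  show ?C
  proof (rule Lim_transform_eventually)
    show "((\<lambda>x :: real. 4 * (x powr ((\<alpha> - 1) / 2) * ln (1/x) powr ((\<alpha> + 1) / 2))) \<longlongrightarrow> 0) (at_right 0)"
      using assms by real_asymp
    show "\<forall>\<^sub>F x in at_right 0. 4 * (x powr ((\<alpha> - 1) / 2) * ln (1/x) powr ((\<alpha> + 1) / 2)) =
        (2 * (2 * sqrt (ln (1/x)))) ^ 1 * (x powr \<alpha> * ln (1/x) powr ((\<alpha> + 1) / 2) * sqrt x powr (1 - \<alpha>)) / (x * sqrt (ln (1/x)))"
      using small_ln_pos
    proof eventually_elim
      case (elim x)
      have "x powr \<alpha> * ln (1/x) powr ((\<alpha> + 1) / 2) * sqrt x powr (1 - \<alpha>) = (x powr \<alpha> * sqrt x powr (1 - \<alpha>)) * ln (1/x) powr ((\<alpha> + 1) / 2)"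
        by (simp only: mult_ac)
      also have "\<dots> = x powr ((\<alpha> - 1) / 2) * x * ln (1/x) powr ((\<alpha> + 1) / 2)"
        using elim by (simp add: powr_times_sqrt_powr)
      finally have *: "x powr \<alpha> * ln (1/x) powr ((\<alpha> + 1) / 2) * sqrt x powr (1 - \<alpha>) = x powr ((\<alpha> - 1) / 2) * x * ln (1/x) powr ((\<alpha> + 1) / 2)" .
      show ?case unfolding * using elim by (simp del: ln_div)
    qed
  qed
qed

lemma bounded_polynomial_times_gaussian:
  fixes \<alpha> l :: real
  assumes "1 < \<alpha>" "0 < l"
  obtains B where "\<And>u. 0 \<le> u \<Longrightarrow> u\<^sup>2 * (2 * u) powr \<alpha> * exp (- l * u\<^sup>2) \<le> B"
proof -
  have "((\<lambda>u. u\<^sup>2 * (2 * u) powr \<alpha> * exp (- l * u\<^sup>2)) \<longlongrightarrow> 0) at_top"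
    using assms by real_asymp
  then have "\<forall>\<^sub>F u in at_top. u\<^sup>2 * (2 * u) powr \<alpha> * exp (- l * u\<^sup>2) < 1"
    by (rule order_tendstoD) simp
  then obtain U where U: "\<And>u. U \<le> u \<Longrightarrow> u\<^sup>2 * (2 * u) powr \<alpha> * exp (- l * u\<^sup>2) < 1"
    by (auto simp: eventually_at_top_linorder)
  show ?thesis
  proof (rule that)
    fix u :: real assume u: "0 \<le> u"
    show "u\<^sup>2 * (2 * u) powr \<alpha> * exp (- l * u\<^sup>2) \<le> max 1 (U\<^sup>2 * (2 * U) powr \<alpha> * 1)"
    proof (cases "U \<le> u")
      case True
      then show ?thesis using U[of u] by simp
    next
      case False
      then have "u\<^sup>2 * (2 * u) powr \<alpha> * exp (- l * u\<^sup>2) \<le> U\<^sup>2 * (2 * U) powr \<alpha> * 1"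
        using u assms by (intro mult_mono power_mono powr_mono2) auto
      then show ?thesis by simp
    qed
  qed
qed

lemma prior_rate_tendsto_0:
  fixes \<alpha> :: real
  assumes "1 < \<alpha>"
  shows "((\<lambda>x :: real. (x * ln (1/x)) powr \<alpha>) \<longlongrightarrow> 0) (at_right 0)"
  using assms by real_asymp

text \<open>The coordinate bounds along a sequence, with \<open>T = 2 sqrt (ln (1/r))\<close>, so that \<open>exp (-T\<^sup>2/4) = r\<close>, with
  upper level \<open>sqrt r\<close>, and with a lower level whose \<open>k\<close>-th power is \<open>r\<close>. Only three ratios to the loss
  scale \<open>\<rho>\<close> then remain to be controlled. The cases \<open>k = 2\<close> and \<open>k = 1\<close> serve the two distances.\<close>

lemma expected_posterior_tendsto_0:
  fixes f \<delta>1 \<rho> b' :: "real \<Rightarrow> real" and \<theta>0 :: "nat \<Rightarrow> nat \<Rightarrow> real" and r b t \<tau> :: "nat \<Rightarrow> real"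
  assumes f: "f \<in> borel_measurable borel" "\<And>x. 0 \<le> f x" and \<alpha>: "1 < \<alpha>"
    and prior: "\<forall>\<^sub>F n in sequentially. 0 < \<tau> n \<and> heavy_tailed_prior (scaled_density f (\<tau> n)) \<alpha> (b n) p0 D K1 K2"
    and k: "1 \<le> k" "k \<le> 2" and \<kappa>: "0 \<le> \<kappa>" "\<kappa> < 1/2" and c: "0 < c"
    and r: "filterlim r (at_right 0) sequentially"
    and count: "\<forall>\<^sub>F n in sequentially. 0 < n \<and> real (nonzero_count n (\<theta>0 n)) = real n * r n"
    and t: "\<forall>\<^sub>F n in sequentially. 0 \<le> t n \<and> exp (- \<kappa> * (t n)\<^sup>2) \<le> b n"
    and b': "\<forall>\<^sub>F n in sequentially. b n \<le> b' (r n)"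
    and \<delta>1: "\<forall>\<^sub>F x in at_right 0. 0 < \<delta>1 x \<and> \<delta>1 x ^ k = x"
    and \<rho>: "\<forall>\<^sub>F x in at_right 0. 0 < \<rho> x"
    and P: "\<forall>\<^sub>F n in sequentially. \<forall>\<theta> y. P n \<theta> \<longrightarrow>
        real n * (c * \<rho> (r n)) \<le> (\<Sum>i<n. coordinate_dev (\<theta>0 n i) (t n) (y i) (\<theta> i) ^ k)"
    and rates: "((\<lambda>x. x / \<rho> x) \<longlongrightarrow> 0) (at_right 0)"
      "((\<lambda>x. sqrt x ^ k * (b' x * \<delta>1 x powr (1 - \<alpha>)) / \<rho> x) \<longlongrightarrow> 0) (at_right 0)"
      "((\<lambda>x. (2 * (2 * sqrt (ln (1/x)))) ^ k * (b' x * sqrt x powr (1 - \<alpha>)) / \<rho> x) \<longlongrightarrow> 0) (at_right 0)"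
  shows "(\<lambda>n. expected_posterior n f (\<tau> n) (\<theta>0 n) (P n)) \<longlonglongrightarrow> 0"
proof -
  obtain B where B: "\<And>u. 0 \<le> u \<Longrightarrow> u\<^sup>2 * (2 * u) powr \<alpha> * exp (- (1/2 - \<kappa>) * u\<^sup>2) \<le> B"
    using bounded_polynomial_times_gaussian[of \<alpha> "1/2 - \<kappa>"] \<alpha> \<kappa> by auto
  define c0 where "c0 = exp (-1/2) * p0"
  define ct where "ct = std_normal_density (1/2) * K1 * 2 powr (- \<alpha>)"
  define E where "E = 2 * (3 + (B / ct + K2 * 2 powr \<alpha> / ct + 1 / (c0 * std_normal_density 1)))"
  define A where "A = (16 + 4 / c0) * 16"
  define R where "R = (\<lambda>x. (\<delta>1 x ^ k + sqrt x ^ k * (D * b' x * \<delta>1 x powr (1 - \<alpha>))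
      + (2 * (2 * sqrt (ln (1/x)))) ^ k * (D * b' x * sqrt x powr (1 - \<alpha>))) / c0
      + A * exp (- (2 * sqrt (ln (1/x)))\<^sup>2 / 4))"
  define U where "U = (\<lambda>x. (x * E + R x) / (c * \<rho> x))"
  have "(U \<longlongrightarrow> 0) (at_right 0)"
  proof (rule Lim_transform_eventually)
    have "((\<lambda>x. (E + 1 / c0 + A) / c * (x / \<rho> x)
        + D / (c0 * c) * (sqrt x ^ k * (b' x * \<delta>1 x powr (1 - \<alpha>)) / \<rho> x)
        + D / (c0 * c) * ((2 * (2 * sqrt (ln (1/x)))) ^ k * (b' x * sqrt x powr (1 - \<alpha>)) / \<rho> x))
        \<longlongrightarrow> (E + 1 / c0 + A) / c * 0 + D / (c0 * c) * 0 + D / (c0 * c) * 0) (at_right 0)"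
      by (intro tendsto_add tendsto_mult tendsto_const rates)
    then show "((\<lambda>x. (E + 1 / c0 + A) / c * (x / \<rho> x)
        + D / (c0 * c) * (sqrt x ^ k * (b' x * \<delta>1 x powr (1 - \<alpha>)) / \<rho> x)
        + D / (c0 * c) * ((2 * (2 * sqrt (ln (1/x)))) ^ k * (b' x * sqrt x powr (1 - \<alpha>)) / \<rho> x))
        \<longlongrightarrow> 0) (at_right 0)" by simp
    show "\<forall>\<^sub>F x in at_right 0. (E + 1 / c0 + A) / c * (x / \<rho> x)
        + D / (c0 * c) * (sqrt x ^ k * (b' x * \<delta>1 x powr (1 - \<alpha>)) / \<rho> x)
        + D / (c0 * c) * ((2 * (2 * sqrt (ln (1/x)))) ^ k * (b' x * sqrt x powr (1 - \<alpha>)) / \<rho> x) = U x"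
      using small_ln_pos \<delta>1
    proof eventually_elim
      case (elim x)
      have "(sqrt (ln (1/x)))\<^sup>2 = ln (1/x)" using elim by (intro real_sqrt_pow2) auto
      then have "(2 * sqrt (ln (1/x)))\<^sup>2 = 4 * ln (1/x)"
        by (simp only: power_mult_distrib) simp
      then have "exp (- (2 * sqrt (ln (1/x)))\<^sup>2 / 4) = exp (- ln (1/x))" by simp
      also have "\<dots> = inverse (1 / x)" using elim by (subst exp_minus, subst exp_ln) auto
      also have "\<dots> = x" by simp
      finally have e: "exp (- (2 * sqrt (ln (1/x)))\<^sup>2 / 4) = x" .
      have d: "\<delta>1 x ^ k = x" using elim by simp
      have gen: "(E + 1 / c0 + A) / c * (x / p) + D / (c0 * c) * (s1 * (v * s2) / p) + D / (c0 * c) * (s3 * (v * s4) / p)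
         = (x * E + ((x + s1 * (D * v * s2) + s3 * (D * v * s4)) / c0 + A * x)) / (c * p)" for p v s1 s2 s3 s4
        by (simp add: add_divide_distrib distrib_left distrib_right mult_ac)
      show ?case unfolding U_def R_def e d by (rule gen)
    qed
  qed
  then have U: "(\<lambda>n. U (r n)) \<longlonglongrightarrow> 0" by (rule filterlim_compose[OF _ r])
  have pos: "\<forall>\<^sub>F x in at_right 0. 0 < x \<and> x < 1 \<and> 1 \<le> ln (1 / x) \<and> 0 < \<delta>1 x \<and> 0 < \<rho> x"
  proof -
    have "\<forall>\<^sub>F x :: real in at_right 0. x < 1" "\<forall>\<^sub>F x :: real in at_right 0. 1 \<le> ln (1 / x)" by real_asymp+
    then show ?thesis using small_ln_pos \<delta>1 \<rho> by eventually_elim auto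
  qed
  have pos_n: "\<forall>\<^sub>F n in sequentially. 0 < r n \<and> r n < 1 \<and> 1 \<le> ln (1 / r n) \<and> 0 < \<delta>1 (r n) \<and> 0 < \<rho> (r n)"
    using eventually_compose_filterlim[OF pos r] .
  have "\<forall>\<^sub>F n in sequentially. expected_posterior n f (\<tau> n) (\<theta>0 n) (P n) \<le> U (r n)"
    using prior count t b' P pos_n
  proof eventually_elim
    case (elim n)
    interpret heavy_tailed_prior "scaled_density f (\<tau> n)" \<alpha> "b n" p0 D K1 K2
      using elim by simp
    let ?x = "r n" and ?T = "2 * sqrt (ln (1 / r n))"
    have T: "2 \<le> ?T" using elim by simp
    have \<delta>2: "sqrt ?x \<le> 2 * ?T"
    proof -
      have "sqrt ?x \<le> 1" using elim by (simp add: real_sqrt_le_1_iff)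
      then show ?thesis using T by linarith
    qed
    have "expected_posterior n f (\<tau> n) (\<theta>0 n) (P n)
      \<le> (real (nonzero_count n (\<theta>0 n)) * (2 * (3 + excess_const B)) + real n * null_risk (b' ?x) k (\<delta>1 ?x) (sqrt ?x) ?T)
         / (real n * (c * \<rho> ?x))"
    proof (rule posterior_deviation_le[OF f _ refl k _ _ \<kappa>(1) B T _ _ _ \<delta>2])
      show "real n * (c * \<rho> (r n)) \<le> (\<Sum>i<n. coordinate_dev (\<theta>0 n i) (t n) (y i) (\<theta> i) ^ k)"
        if "P n \<theta>" for \<theta> y using elim that by blast
    qed (use elim c in auto)
    also have "real (nonzero_count n (\<theta>0 n)) * (2 * (3 + excess_const B)) + real n * null_risk (b' ?x) k (\<delta>1 ?x) (sqrt ?x) ?T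
       = real n * (?x * E + R ?x)"
      using elim
      by (simp only: excess_const_def null_risk_def c_origin_def[folded c0_def] c_tail_def[folded ct_def] E_def R_def A_def)
         (simp only: distrib_left mult.assoc)
    also have "real n * (?x * E + R ?x) / (real n * (c * \<rho> ?x)) = U ?x"
      using elim by (simp add: U_def)
    finally show ?case .
  qed
  then show ?thesis
    by (intro tendsto_sandwich[OF _ _ tendsto_const U]) (auto simp: expected_posterior_nonneg)
qed

section \<open>Posterior concentration\<close>

lemma C1_tendsto: "(C1 \<longlongrightarrow> sqrt 2) (at_right 0)" 
  unfolding C1_def by (auto intro!: tendsto_eq_intros)

lemma C2_tendsto: "(C2 \<longlongrightarrow> sqrt 2) (at_right 0)" 
  unfolding C2_def by (auto intro!: tendsto_eq_intros)

theorem theorem2p1: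
  fixes \<omega> \<alpha> :: real
    and \<pi>0 :: "real \<Rightarrow> real"
    and \<theta>star :: "nat \<Rightarrow> nat \<Rightarrow> real"
    and s :: "nat \<Rightarrow> nat"
    and \<tau> :: "nat \<Rightarrow> real"
  assumes "\<omega> > 0"
    and "\<alpha> > 1"
    and "probability_density \<pi>0"
    and "unimodal_at_zero \<pi>0"
    and "polynomial_tail \<alpha> \<pi>0"
    and "\<forall>n\<ge>1. nonzero_count n (\<theta>star n) = s n"
    and "\<forall>n\<ge>1. s n \<ge> 1"
    and "(\<lambda>n. real (s n)) \<in> o(\<lambda>n. real n)"
    and "\<forall>n\<ge>1. \<tau> n > 0"
    and "\<exists>c. 0 < c \<and> c < 1 + \<omega> / 2 \<and>
           (\<forall>n\<ge>1. \<tau> n powr (\<alpha> - 1) \<ge> (real (s n) / real n) powr c * sqrt (ln (real n / real (s n))))"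
    and "(\<lambda>n. \<tau> n powr (\<alpha> - 1)) \<prec>\<prec>
           (\<lambda>n. (real (s n) / real n * ln (real n / real (s n))) powr \<alpha>)"
  shows "((\<lambda>n. expected_posterior n \<pi>0 (\<tau> n) (\<theta>star n)
            (\<lambda>\<theta>. l2_dist n \<theta> (\<theta>star n) \<ge> C1 \<omega> * sqrt (real (s n) * ln (real n / real (s n)))))
            \<longlonglongrightarrow> 0)
       \<and> (C1 \<longlongrightarrow> sqrt 2) (at_right 0)
       \<and> ((\<lambda>n. \<tau> n powr (\<alpha> - 1)) \<prec>\<prec>
            (\<lambda>n. (real (s n) / real n) powr \<alpha> * ln (real n / real (s n)) powr ((\<alpha> + 1) / 2))
          \<longrightarrow> (\<lambda>n. expected_posterior n \<pi>0 (\<tau> n) (\<theta>star n)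
                (\<lambda>\<theta>. l1_dist n \<theta> (\<theta>star n) \<ge> real (s n) * C2 \<omega> * sqrt (ln (real n / real (s n)))))
                \<longlonglongrightarrow> 0)
       \<and> (C2 \<longlongrightarrow> sqrt 2) (at_right 0)"
proof -
  note \<omega> = assms(1) and \<alpha> = assms(2) and count = assms(6) and s_pos = assms(7)
    and sparse = assms(8) and \<tau>_pos = assms(9)
  have f: "\<pi>0 \<in> borel_measurable borel" "\<And>x. 0 \<le> \<pi>0 x"
    using assms(3) unfolding probability_density_def by blast+
  obtain c where c: "0 < c" "c < 1 + \<omega> / 2"
    and \<tau>_ge: "\<And>n. 1 \<le> n \<Longrightarrow> (real (s n) / real n) powr c * sqrt (ln (real n / real (s n))) \<le> \<tau> n powr (\<alpha> - 1)"
    using assms(10) by blast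
  obtain p0 D K1 K2 \<tau>0 where \<tau>0: "0 < \<tau>0"
    and prior: "\<And>\<tau>. 0 < \<tau> \<Longrightarrow> \<tau> < \<tau>0 \<Longrightarrow> heavy_tailed_prior (scaled_density \<pi>0 \<tau>) \<alpha> (\<tau> powr (\<alpha> - 1)) p0 D K1 K2"
    by (rule scaled_prior_heavy_tailed[OF assms(3-5) \<alpha>], rule that)
  define r where "r n = real (s n) / real n" for n
  define b where "b n = \<tau> n powr (\<alpha> - 1)" for n
  define t where "t n = sqrt ((2 + \<omega>) * ln (1 / r n))" for n
  \<comment> \<open>Then \<open>\<kappa> * (t n)\<^sup>2 = c * ln (n/s)\<close>, and \<open>c < 1 + \<omega>/2\<close> is exactly \<open>\<kappa> < 1/2\<close>.\<close>
  define \<kappa> where "\<kappa> = c / (2 + \<omega>)"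
  have \<kappa>: "0 \<le> \<kappa>" "\<kappa> < 1/2" using c \<omega> by (auto simp: \<kappa>_def field_simps)
  have inv_r: "real n / real (s n) = 1 / r n" for n by (simp add: r_def)
  have s_eq: "real (s n) = real n * r n" if "1 \<le> n" for n using that by (simp add: r_def)
  have ev1: "\<forall>\<^sub>F n :: nat in sequentially. 1 \<le> n" by (rule eventually_ge_at_top)
  have r_lim: "filterlim r (at_right 0) sequentially"
  proof -
    have "r \<longlonglongrightarrow> 0" unfolding r_def by (rule smalloD_tendsto[OF sparse])
    moreover have "\<forall>\<^sub>F n in sequentially. r n \<in> {0<..}"
      using ev1 by eventually_elim (use s_pos in \<open>force simp: r_def\<close>)
    ultimately show ?thesis by (simp add: filterlim_at eventually_conj_iff) (auto elim: eventually_mono)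
  qed
  have r_small: "\<forall>\<^sub>F n in sequentially. 0 < r n \<and> 1 \<le> ln (1 / r n)"
  proof -
    have "\<forall>\<^sub>F x :: real in at_right 0. 1 \<le> ln (1 / x)" by real_asymp
    then have "\<forall>\<^sub>F x :: real in at_right 0. 0 < x \<and> 1 \<le> ln (1 / x)"
      using small_ln_pos by eventually_elim auto
    then show ?thesis by (rule eventually_compose_filterlim[OF _ r_lim])
  qed
  have below: "\<forall>\<^sub>F n in sequentially. b n \<le> g n" if "b \<prec>\<prec> g" for g
  proof -
    have "\<forall>\<^sub>F n in sequentially. 1 \<le> g n / b n"
      using that unfolding precedes_def filterlim_at_top by blast
    then show ?thesis using ev1
    proof eventually_elim
      case (elim n)
      have "0 < \<tau> n" using \<tau>_pos elim by blast
      then have "0 < b n" by (simp add: b_def)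
      then show ?case using elim by (simp add: field_simps)
    qed
  qed
  have b_l2: "\<forall>\<^sub>F n in sequentially. b n \<le> (r n * ln (1 / r n)) powr \<alpha>"
    using below assms(11) unfolding b_def inv_r r_def[symmetric] by blast
  have \<tau>_small: "\<forall>\<^sub>F n in sequentially. \<tau> n < \<tau>0"
  proof -
    have "(\<lambda>n. (r n * ln (1 / r n)) powr \<alpha>) \<longlonglongrightarrow> 0"
      by (rule filterlim_compose[OF prior_rate_tendsto_0[OF \<alpha>] r_lim])
    then have "\<forall>\<^sub>F n in sequentially. (r n * ln (1 / r n)) powr \<alpha> < \<tau>0 powr (\<alpha> - 1)"
      using \<tau>0 by (intro order_tendstoD) auto
    then show ?thesis using b_l2 ev1
    proof eventually_elim
      case (elim n)
      show ?case
      proof (rule ccontr)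
        assume "\<not> \<tau> n < \<tau>0"
        then have "\<tau>0 powr (\<alpha> - 1) \<le> b n" unfolding b_def using \<tau>0 \<alpha> by (intro powr_mono2) auto
        then show False using elim by linarith
      qed
    qed
  qed
  have priors: "\<forall>\<^sub>F n in sequentially. 0 < \<tau> n \<and> heavy_tailed_prior (scaled_density \<pi>0 (\<tau> n)) \<alpha> (b n) p0 D K1 K2"
    using \<tau>_small ev1 by eventually_elim (use prior \<tau>_pos in \<open>auto simp: b_def\<close>)
  have counts: "\<forall>\<^sub>F n in sequentially. 0 < n \<and> real (nonzero_count n (\<theta>star n)) = real n * r n"
    using ev1 by eventually_elim (use count s_eq in auto)
  have thr: "\<forall>\<^sub>F n in sequentially. 0 \<le> t n \<and> exp (- \<kappa> * (t n)\<^sup>2) \<le> b n"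
    using r_small ev1
  proof eventually_elim
    case (elim n)
    have nn: "0 \<le> (2 + \<omega>) * ln (1 / r n)"
      by (rule mult_nonneg_nonneg) (use elim \<omega> in linarith)+
    have t2: "(t n)\<^sup>2 = (2 + \<omega>) * ln (1 / r n)"
      unfolding t_def by (rule real_sqrt_pow2[OF nn])
    have "exp (- \<kappa> * (t n)\<^sup>2) = exp (c * - ln (1 / r n))" unfolding t2 \<kappa>_def using \<omega> by simp
    also have "\<dots> = r n powr c" using elim by (simp add: powr_def ln_div)
    also have "\<dots> = r n powr c * 1" by simp
    also have "\<dots> \<le> r n powr c * sqrt (ln (1 / r n))"
      by (intro mult_left_mono) (use elim in simp_all)
    also have "\<dots> \<le> b n" using \<tau>_ge[of n] elim by (simp only: b_def inv_r r_def[symmetric])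
    finally have "exp (- \<kappa> * (t n)\<^sup>2) \<le> b n" .
    moreover have "0 \<le> t n"
      unfolding t_def by (rule real_sqrt_ge_zero[OF nn])
    ultimately show ?case by blast
  qed
  have \<rho>1: "\<forall>\<^sub>F x :: real in at_right 0. 0 < x * sqrt (ln (1/x))"
    and \<rho>2: "\<forall>\<^sub>F x :: real in at_right 0. 0 < x * ln (1/x)"
    and pos: "\<forall>\<^sub>F x :: real in at_right 0. 0 < x \<and> x ^ 1 = x"
    and sqrt_pos: "\<forall>\<^sub>F x :: real in at_right 0. 0 < sqrt x \<and> sqrt x ^ 2 = x"
    using small_ln_pos by (eventually_elim, simp)+
  have l2: "(\<lambda>n. expected_posterior n \<pi>0 (\<tau> n) (\<theta>star n)
      (\<lambda>\<theta>. l2_dist n \<theta> (\<theta>star n) \<ge> C1 \<omega> * sqrt (real (s n) * ln (real n / real (s n))))) \<longlonglongrightarrow> 0"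
  proof (rule expected_posterior_tendsto_0[OF f \<alpha> priors _ _ \<kappa> \<omega> r_lim counts thr b_l2 sqrt_pos \<rho>2])
    show "\<forall>\<^sub>F n in sequentially. \<forall>\<theta> y. C1 \<omega> * sqrt (real (s n) * ln (real n / real (s n))) \<le> l2_dist n \<theta> (\<theta>star n) \<longrightarrow>
        real n * (\<omega> * (r n * ln (1 / r n))) \<le> (\<Sum>i<n. coordinate_dev (\<theta>star n i) (t n) (y i) (\<theta> i) ^ 2)"
      using r_small ev1
    proof (eventually_elim, intro allI impI)
      fix n \<theta> y
      assume n: "0 < r n \<and> 1 \<le> ln (1 / r n)" "1 \<le> n"
        and far: "C1 \<omega> * sqrt (real (s n) * ln (real n / real (s n))) \<le> l2_dist n \<theta> (\<theta>star n)"
      let ?L = "ln (1 / r n)" and ?S = "\<Sum>i<n. (coordinate_dev (\<theta>star n i) (t n) (y i) (\<theta> i))\<^sup>2"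
      have t0: "0 \<le> t n"
        unfolding t_def
        by (rule real_sqrt_ge_zero, rule mult_nonneg_nonneg) (use n \<omega> in linarith)+
      have "sqrt (real (s n)) * t n = sqrt (2 + \<omega>) * sqrt (real (s n) * ?L)"
        unfolding t_def by (simp only: real_sqrt_mult mult_ac)
      then have "l2_dist n \<theta> (\<theta>star n) \<le> sqrt (2 + \<omega>) * sqrt (real (s n) * ?L) + sqrt ?S"
        using l2_dist_le_coordinate_dev[OF t0, of n \<theta> "\<theta>star n" y] count n by simp
      then have "sqrt \<omega> * sqrt (real (s n) * ?L) \<le> sqrt ?S"
        using far unfolding C1_def inv_r by (simp only: distrib_right)
      then have "sqrt (\<omega> * (real (s n) * ?L)) \<le> sqrt ?S" by (simp only: real_sqrt_mult)
      then have "\<omega> * (real (s n) * ?L) \<le> ?S" by (simp only: real_sqrt_le_iff)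
      then show "real n * (\<omega> * (r n * ?L)) \<le> ?S"
        using s_eq[OF n(2)] by (simp add: mult_ac)
    qed
  qed (use l2_rates[OF \<alpha>] in auto)
  have l1: "(\<lambda>n. expected_posterior n \<pi>0 (\<tau> n) (\<theta>star n)
      (\<lambda>\<theta>. l1_dist n \<theta> (\<theta>star n) \<ge> real (s n) * C2 \<omega> * sqrt (ln (real n / real (s n))))) \<longlonglongrightarrow> 0"
    if "(\<lambda>n. \<tau> n powr (\<alpha> - 1)) \<prec>\<prec>
        (\<lambda>n. (real (s n) / real n) powr \<alpha> * ln (real n / real (s n)) powr ((\<alpha> + 1) / 2))"
  proof -
    have b_l1: "\<forall>\<^sub>F n in sequentially. b n \<le> r n powr \<alpha> * ln (1 / r n) powr ((\<alpha> + 1) / 2)"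
      using below that unfolding b_def inv_r r_def[symmetric] by blast
    \<comment> \<open>The part of \<open>C2 \<omega>\<close> beyond the threshold term \<open>sqrt (2 + \<omega>)\<close>.\<close>
    let ?c = "sqrt (\<omega>\<^sup>2 / 5) + sqrt (\<omega> / 5)"
    have c_pos: "0 < ?c" using \<omega> by (intro add_pos_pos) auto
    show ?thesis
    proof (rule expected_posterior_tendsto_0[OF f \<alpha> priors _ _ \<kappa> c_pos r_lim counts thr b_l1 pos \<rho>1])
      show "\<forall>\<^sub>F n in sequentially. \<forall>\<theta> y. real (s n) * C2 \<omega> * sqrt (ln (real n / real (s n))) \<le> l1_dist n \<theta> (\<theta>star n) \<longrightarrow>
          real n * (?c * (r n * sqrt (ln (1 / r n)))) \<le> (\<Sum>i<n. coordinate_dev (\<theta>star n i) (t n) (y i) (\<theta> i) ^ 1)"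
        using r_small ev1
      proof (eventually_elim, intro allI impI)
        fix n \<theta> y
        assume n: "0 < r n \<and> 1 \<le> ln (1 / r n)" "1 \<le> n"
          and far: "real (s n) * C2 \<omega> * sqrt (ln (real n / real (s n))) \<le> l1_dist n \<theta> (\<theta>star n)"
        let ?l = "sqrt (ln (1 / r n))" and ?S = "\<Sum>i<n. coordinate_dev (\<theta>star n i) (t n) (y i) (\<theta> i)"
        have "real (s n) * t n = real (s n) * sqrt (2 + \<omega>) * ?l"
          unfolding t_def by (simp only: real_sqrt_mult mult_ac)
        moreover have "nonzero_count n (\<theta>star n) = s n" using count n by blast
        ultimately have "l1_dist n \<theta> (\<theta>star n) \<le> real (s n) * sqrt (2 + \<omega>) * ?l + ?S"
          using l1_dist_le_coordinate_dev[of n \<theta> "\<theta>star n" "t n" y] by (simp only:)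
        moreover have "real (s n) * C2 \<omega> * ?l = real (s n) * sqrt (2 + \<omega>) * ?l + real (s n) * ?c * ?l"
          unfolding C2_def by (simp only: distrib_left distrib_right add.assoc)
        ultimately have "real (s n) * ?c * ?l \<le> ?S"
          using far unfolding inv_r by linarith
        then show "real n * (?c * (r n * ?l)) \<le> (\<Sum>i<n. coordinate_dev (\<theta>star n i) (t n) (y i) (\<theta> i) ^ 1)"
          unfolding s_eq[OF n(2)] power_one_right by (simp only: mult_ac)
      qed
    qed (use l1_rates[OF \<alpha>] in auto)
  qed
  show ?thesis using l2 l1 C1_tendsto C2_tendsto by blast
qed

end
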